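(* Let $(M^3,\varphi,\xi,\eta,g)$ be a three-dimensional contact metric manifold satisfying $Q\xi=\sigma\xi$, where $Q$ is the Ricci operator and $\sigma$ is a smooth function such that $\xi(\sigma)=0$. Assume that $g$ defines an almost Ricci--Bourguignon soliton $$\operatorname{Ric}+\tfrac12\mathcal{L}_Vg=(\lambda+\rho r)g$$ (with $\lambda$ a smooth function on $M$, $\rho\in\mathbb{R}$ a constant, and $r$ the scalar curvature) whose potential vector field is pointwise collinear with the Reeb vector field, that is, $V=f\xi$ for some smooth function $f$ on $M$. Then $f=0$ on the open set $U=\{p\in M:h_p\neq0\}$. Consequently, if $V$ is nowhere vanishing on $M$, then $U=\varnothing$, and hence $M$ is $K$-contact; in particular, since $\dim M=3$, $M$ is Sasakian. Equivalently, a non-Sasakian contact metric three-manifold satisfying $Q\xi=\sigma\xi$ with $\xi(\sigma)=0$ admits no almost Ricci--Bourguignon soliton whose potential vector field is nowhere vanishing and pointwise collinear with $\xi$.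
   Context: A contact metric manifold $(M^{2n+1},\varphi,\xi,\eta,g)$ is a Riemannian manifold $(M,g)$ with a global 1-form $\eta$ satisfying $\eta\wedge(d\eta)^n\neq0$ everywhere, a unit vector field $\xi$ (the Reeb vector field) with $\eta(\xi)=1$ and $d\eta(\xi,\cdot)=0$, and a $(1,1)$-tensor field $\varphi$ with $d\eta(X,Y)=g(X,\varphi Y)$, $\eta(X)=g(X,\xi)$, $\varphi^2X=-X+\eta(X)\xi$. The normalization is $d\eta(X,Y)=\frac12\{X\eta(Y)-Y\eta(X)-\eta([X,Y])\}$, so that $\nabla_X\xi=-\varphi X-\varphi hX$, where $\nabla$ is the Levi-Civita connection and $h=\frac12\mathcal{L}_\xi\varphi$. The manifold is $K$-contact if $\xi$ is Killing, equivalently $h=0$. It is Sasakian if $(\nabla_X\varphi)Y=g(X,Y)\xi-\eta(Y)X$ for all $X,Y$; a Sasakian manifold is $K$-contact, and in dimension 3 the converse holds. The Ricci operator $Q$ is defined by $\operatorname{Ric}(X,Y)=g(QX,Y)$. $\mathcal{L}_Vg$ is the Lie derivative of $g$ along $V$. *)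

theory Defs
  imports "HOL-Analysis.Analysis" "HOL-Library.Function_Algebras"
begin

text \<open>The pointwise real vector space structure on functions. It is used for tangent vectors
  (functionals on functions) and for vector fields (functions into tangent vectors).\<close>

instantiation "fun" :: (type, real_vector) real_vector
begin

definition scaleR_fun_def: "c *\<^sub>R f = (\<lambda>x. c *\<^sub>R f x)"

instance
  by standard (simp_all add: scaleR_fun_def fun_eq_iff scaleR_add_left scaleR_add_right)

end


section \<open>Smooth manifolds, tangent vectors, vector fields\<close>

text \<open>\<open>C_k_on k S f\<close> is meant for open \<open>S\<close>; on open sets, existence and continuity of all
  iterated directional derivatives together with Frechet differentiability at each stage is the
  usual notion of \<open>C\<^sup>k\<close>.\<close>

fun C_k_on :: "nat \<Rightarrow> 'e::euclidean_space set \<Rightarrow> ('e \<Rightarrow> 'f::real_normed_vector) \<Rightarrow> bool" where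
  "C_k_on 0 S f \<longleftrightarrow> continuous_on S f"
| "C_k_on (Suc k) S f \<longleftrightarrow> (\<forall>x\<in>S. f differentiable (at x)) \<and>
     (\<forall>v. C_k_on k S (\<lambda>x. frechet_derivative f (at x) v))"

definition C_inf_on :: "'e::euclidean_space set \<Rightarrow> ('e \<Rightarrow> 'f::real_normed_vector) \<Rightarrow> bool" where
  "C_inf_on S f \<longleftrightarrow> (\<forall>k. C_k_on k S f)"

text \<open>The underlying space of a manifold is the whole of a Hausdorff second countable type
  \<open>'a\<close>; the dimension is that of the model space \<open>'e\<close>. A chart is a pair of a domain and a map
  whose values outside the domain are irrelevant. The atlas need not be maximal.\<close>

type_synonym ('a, 'e) atlas = "('a set \<times> ('a \<Rightarrow> 'e)) set"

definition smooth_atlas ::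
  "('a::{t2_space,second_countable_topology}, 'e::euclidean_space) atlas \<Rightarrow> bool" where
  "smooth_atlas A \<longleftrightarrow>
     (\<forall>(U, \<psi>)\<in>A. open U \<and> open (\<psi> ` U) \<and> (\<exists>\<psi>'. homeomorphism U (\<psi> ` U) \<psi> \<psi>')) \<and>
     (\<Union>(U, \<psi>)\<in>A. U) = UNIV \<and>
     (\<forall>(U, \<psi>)\<in>A. \<forall>(W, \<theta>)\<in>A. C_inf_on (\<psi> ` (U \<inter> W)) (\<theta> \<circ> inv_into U \<psi>))"

definition smooth_fun :: "('a, 'e::euclidean_space) atlas \<Rightarrow> ('a \<Rightarrow> real) \<Rightarrow> bool" where
  "smooth_fun A f \<longleftrightarrow> (\<forall>(U, \<psi>)\<in>A. C_inf_on (\<psi> ` U) (f \<circ> inv_into U \<psi>))"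

text \<open>Tangent vectors at \<open>p\<close> are the derivations at \<open>p\<close> of the algebra of smooth functions. Since
  HOL functions are total, they are made canonical by letting them vanish on non-smooth
  functions, so that equality of tangent vectors is equality in HOL.\<close>

type_synonym 'a tangent = "('a \<Rightarrow> real) \<Rightarrow> real"

definition tangent_space :: "('a, 'e::euclidean_space) atlas \<Rightarrow> 'a \<Rightarrow> 'a tangent set" where
  "tangent_space A p = {v.
     (\<forall>f h. smooth_fun A f \<longrightarrow> smooth_fun A h \<longrightarrow> v (f + h) = v f + v h) \<and>
     (\<forall>c f. smooth_fun A f \<longrightarrow> v (c *\<^sub>R f) = c * v f) \<and>
     (\<forall>f h. smooth_fun A f \<longrightarrow> smooth_fun A h \<longrightarrow> v (f * h) = f p * v h + h p * v f) \<and>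
     (\<forall>f. \<not> smooth_fun A f \<longrightarrow> v f = 0)}"

type_synonym 'a vfield = "'a \<Rightarrow> 'a tangent"

definition deriv_along :: "'a vfield \<Rightarrow> ('a \<Rightarrow> real) \<Rightarrow> 'a \<Rightarrow> real" where
  "deriv_along X f = (\<lambda>p. X p f)"

definition vector_field :: "('a, 'e::euclidean_space) atlas \<Rightarrow> 'a vfield \<Rightarrow> bool" where
  "vector_field A X \<longleftrightarrow> (\<forall>p. X p \<in> tangent_space A p) \<and>
     (\<forall>f. smooth_fun A f \<longrightarrow> smooth_fun A (deriv_along X f))"

definition scale_field :: "('a \<Rightarrow> real) \<Rightarrow> 'a vfield \<Rightarrow> 'a vfield"  (infixr \<open>\<odot>\<close> 75) where
  "f \<odot> X = (\<lambda>p. f p *\<^sub>R X p)"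

definition lie_bracket :: "'a vfield \<Rightarrow> 'a vfield \<Rightarrow> 'a vfield" where
  "lie_bracket X Y = (\<lambda>p f. X p (deriv_along Y f) - Y p (deriv_along X f))"


section \<open>Tensor fields\<close>

text \<open>Tensor fields assign to each point a (multi)linear map on the tangent space; what these maps
  do outside the tangent space is irrelevant. Smoothness is tested on smooth vector fields.\<close>

type_synonym 'a one_form = "'a \<Rightarrow> 'a tangent \<Rightarrow> real"
type_synonym 'a endo_field = "'a \<Rightarrow> 'a tangent \<Rightarrow> 'a tangent"
type_synonym 'a bilin_field = "'a \<Rightarrow> 'a tangent \<Rightarrow> 'a tangent \<Rightarrow> real"

definition form_app :: "'a one_form \<Rightarrow> 'a vfield \<Rightarrow> 'a \<Rightarrow> real" where
  "form_app \<eta> X = (\<lambda>p. \<eta> p (X p))"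

definition endo_app :: "'a endo_field \<Rightarrow> 'a vfield \<Rightarrow> 'a vfield" where
  "endo_app \<phi> X = (\<lambda>p. \<phi> p (X p))"

definition bilin_app :: "'a bilin_field \<Rightarrow> 'a vfield \<Rightarrow> 'a vfield \<Rightarrow> 'a \<Rightarrow> real" where
  "bilin_app g X Y = (\<lambda>p. g p (X p) (Y p))"

definition linear_on_space ::
  "'v::real_vector set \<Rightarrow> ('v \<Rightarrow> 'w::real_vector) \<Rightarrow> bool" where
  "linear_on_space S L \<longleftrightarrow>
     (\<forall>v\<in>S. \<forall>w\<in>S. L (v + w) = L v + L w) \<and> (\<forall>c. \<forall>v\<in>S. L (c *\<^sub>R v) = c *\<^sub>R L v)"

definition smooth_one_form :: "('a, 'e::euclidean_space) atlas \<Rightarrow> 'a one_form \<Rightarrow> bool" where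
  "smooth_one_form A \<eta> \<longleftrightarrow> (\<forall>p. linear_on_space (tangent_space A p) (\<eta> p)) \<and>
     (\<forall>X. vector_field A X \<longrightarrow> smooth_fun A (form_app \<eta> X))"

definition smooth_endo_field :: "('a, 'e::euclidean_space) atlas \<Rightarrow> 'a endo_field \<Rightarrow> bool" where
  "smooth_endo_field A \<phi> \<longleftrightarrow>
     (\<forall>p. linear_on_space (tangent_space A p) (\<phi> p) \<and> \<phi> p ` tangent_space A p \<subseteq> tangent_space A p) \<and>
     (\<forall>X. vector_field A X \<longrightarrow> vector_field A (endo_app \<phi> X))"

definition riemannian_metric :: "('a, 'e::euclidean_space) atlas \<Rightarrow> 'a bilin_field \<Rightarrow> bool" where
  "riemannian_metric A g \<longleftrightarrow>
     (\<forall>p. (\<forall>v\<in>tangent_space A p. linear_on_space (tangent_space A p) (g p v)) \<and>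
          (\<forall>v\<in>tangent_space A p. \<forall>w\<in>tangent_space A p. g p v w = g p w v) \<and>
          (\<forall>v\<in>tangent_space A p. v \<noteq> 0 \<longrightarrow> g p v v > 0)) \<and>
     (\<forall>X Y. vector_field A X \<longrightarrow> vector_field A Y \<longrightarrow> smooth_fun A (bilin_app g X Y))"

text \<open>The exterior derivative of a 1-form with the normalization used in contact metric geometry,
  i.e. including the factor 1/2.\<close>

definition ext_deriv :: "'a one_form \<Rightarrow> 'a vfield \<Rightarrow> 'a vfield \<Rightarrow> 'a \<Rightarrow> real" where
  "ext_deriv \<eta> X Y = (\<lambda>p. (1/2) *
     (deriv_along X (form_app \<eta> Y) p - deriv_along Y (form_app \<eta> X) p
        - form_app \<eta> (lie_bracket X Y) p))"

definition lie_deriv_bilin :: "'a vfield \<Rightarrow> 'a bilin_field \<Rightarrow> 'a vfield \<Rightarrow> 'a vfield \<Rightarrow> 'a \<Rightarrow> real" where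
  "lie_deriv_bilin V g X Y = (\<lambda>p. deriv_along V (bilin_app g X Y) p
     - bilin_app g (lie_bracket V X) Y p - bilin_app g X (lie_bracket V Y) p)"

definition lie_deriv_endo :: "'a vfield \<Rightarrow> 'a endo_field \<Rightarrow> 'a vfield \<Rightarrow> 'a vfield" where
  "lie_deriv_endo V \<phi> X = lie_bracket V (endo_app \<phi> X) - endo_app \<phi> (lie_bracket V X)"


section \<open>Levi-Civita connection and curvature\<close>

text \<open>Torsion-free metric connections on the tangent bundle. By the fundamental theorem of
  Riemannian geometry there is, on vector fields, exactly one such \<open>D\<close> for every Riemannian
  metric \<open>g\<close>.\<close>

definition levi_civita ::
  "('a, 'e::euclidean_space) atlas \<Rightarrow> 'a bilin_field \<Rightarrow> ('a vfield \<Rightarrow> 'a vfield \<Rightarrow> 'a vfield) \<Rightarrow> bool"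
  where
  "levi_civita A g D \<longleftrightarrow>
     (\<forall>X Y. vector_field A X \<longrightarrow> vector_field A Y \<longrightarrow>
        vector_field A (D X Y) \<and>
        D X Y - D Y X = lie_bracket X Y \<and>
        (\<forall>f. smooth_fun A f \<longrightarrow>
           D (f \<odot> X) Y = f \<odot> D X Y \<and>
           D X (f \<odot> Y) = f \<odot> D X Y + deriv_along X f \<odot> Y) \<and>
        (\<forall>Z. vector_field A Z \<longrightarrow>
           D (X + Y) Z = D X Z + D Y Z \<and>
           D Z (X + Y) = D Z X + D Z Y \<and>
           deriv_along Z (bilin_app g X Y) = bilin_app g (D Z X) Y + bilin_app g X (D Z Y)))"

definition curvature ::
  "('a vfield \<Rightarrow> 'a vfield \<Rightarrow> 'a vfield) \<Rightarrow> 'a vfield \<Rightarrow> 'a vfield \<Rightarrow> 'a vfield \<Rightarrow> 'a vfield" where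
  "curvature D X Y Z = D X (D Y Z) - D Y (D X Z) - D (lie_bracket X Y) Z"

text \<open>Traces at \<open>p\<close> are computed in vector fields \<open>E 0, ..., E (DIM('e) - 1)\<close> whose values at \<open>p\<close>
  form an orthonormal basis of the tangent space; nothing is required of them at other points.
  The traces below do not depend on the choice.\<close>

definition orthonormal_at ::
  "('a, 'e::euclidean_space) atlas \<Rightarrow> 'a bilin_field \<Rightarrow> 'a \<Rightarrow> (nat \<Rightarrow> 'a vfield) \<Rightarrow> bool" where
  "orthonormal_at A g p E \<longleftrightarrow> (\<forall>i<DIM('e). vector_field A (E i)) \<and>
     (\<forall>i<DIM('e). \<forall>j<DIM('e). g p (E i p) (E j p) = (if i = j then 1 else 0))"

definition frame_at ::
  "('a, 'e::euclidean_space) atlas \<Rightarrow> 'a bilin_field \<Rightarrow> 'a \<Rightarrow> nat \<Rightarrow> 'a vfield" where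
  "frame_at A g p = (SOME E. orthonormal_at A g p E)"

text \<open>\<open>Ric(X,Y)\<close> is the trace of \<open>Z \<mapsto> R(Z,X)Y\<close>.\<close>

definition ricci ::
  "('a, 'e::euclidean_space) atlas \<Rightarrow> 'a bilin_field \<Rightarrow> ('a vfield \<Rightarrow> 'a vfield \<Rightarrow> 'a vfield) \<Rightarrow>
     'a vfield \<Rightarrow> 'a vfield \<Rightarrow> 'a \<Rightarrow> real" where
  "ricci A g D X Y = (\<lambda>p. \<Sum>i<DIM('e).
     bilin_app g (curvature D (frame_at A g p i) X Y) (frame_at A g p i) p)"

definition ricci_operator ::
  "('a, 'e::euclidean_space) atlas \<Rightarrow> 'a bilin_field \<Rightarrow> ('a vfield \<Rightarrow> 'a vfield \<Rightarrow> 'a vfield) \<Rightarrow>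
     'a vfield \<Rightarrow> 'a vfield" where
  "ricci_operator A g D X = (\<lambda>p. THE v. v \<in> tangent_space A p \<and>
     (\<forall>Y. vector_field A Y \<longrightarrow> ricci A g D X Y p = g p v (Y p)))"

definition scalar_curvature ::
  "('a, 'e::euclidean_space) atlas \<Rightarrow> 'a bilin_field \<Rightarrow> ('a vfield \<Rightarrow> 'a vfield \<Rightarrow> 'a vfield) \<Rightarrow>
     'a \<Rightarrow> real" where
  "scalar_curvature A g D = (\<lambda>p. \<Sum>i<DIM('e).
     ricci A g D (frame_at A g p i) (frame_at A g p i) p)"


section \<open>Contact metric manifolds\<close>

text \<open>Non-vanishing at \<open>p\<close> of \<open>\<eta> \<and> (d\<eta>)\<^sup>n\<close>, where \<open>DIM('e) = 2 n + 1\<close>: up to a positive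
  constant depending only on \<open>n\<close> and on conventions, the sum below is the value of that form on
  \<open>X 0, ..., X (2 n)\<close> at \<open>p\<close>.\<close>

definition contact_at :: "('a, 'e::euclidean_space) atlas \<Rightarrow> 'a one_form \<Rightarrow> 'a \<Rightarrow> bool" where
  "contact_at A \<eta> p \<longleftrightarrow> (\<exists>X. (\<forall>i<DIM('e). vector_field A (X i)) \<and>
     (\<Sum>\<pi> | \<pi> permutes {..<DIM('e)}. real_of_int (sign \<pi>) * form_app \<eta> (X (\<pi> 0)) p *
        (\<Prod>i<(DIM('e) - 1) div 2. ext_deriv \<eta> (X (\<pi> (2*i+1))) (X (\<pi> (2*i+2))) p)) \<noteq> 0)"

definition contact_metric ::
  "('a::{t2_space,second_countable_topology}, 'e::euclidean_space) atlas \<Rightarrow>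
     'a endo_field \<Rightarrow> 'a vfield \<Rightarrow> 'a one_form \<Rightarrow> 'a bilin_field \<Rightarrow> bool" where
  "contact_metric A \<phi> \<xi> \<eta> g \<longleftrightarrow>
     odd DIM('e) \<and> smooth_atlas A \<and> riemannian_metric A g \<and>
     smooth_one_form A \<eta> \<and> (\<forall>p. contact_at A \<eta> p) \<and>
     vector_field A \<xi> \<and> bilin_app g \<xi> \<xi> = 1 \<and> form_app \<eta> \<xi> = 1 \<and>
     (\<forall>X. vector_field A X \<longrightarrow> ext_deriv \<eta> \<xi> X = 0) \<and>
     smooth_endo_field A \<phi> \<and>
     (\<forall>X Y. vector_field A X \<longrightarrow> vector_field A Y \<longrightarrow>
        ext_deriv \<eta> X Y = bilin_app g X (endo_app \<phi> Y)) \<and>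
     (\<forall>X. vector_field A X \<longrightarrow> form_app \<eta> X = bilin_app g X \<xi>) \<and>
     (\<forall>X. vector_field A X \<longrightarrow> endo_app \<phi> (endo_app \<phi> X) = - X + form_app \<eta> X \<odot> \<xi>)"

definition h_tensor :: "'a endo_field \<Rightarrow> 'a vfield \<Rightarrow> 'a vfield \<Rightarrow> 'a vfield" where
  "h_tensor \<phi> \<xi> X = (1/2) *\<^sub>R lie_deriv_endo \<xi> \<phi> X"

text \<open>The set of points where the endomorphism \<open>h\<^sub>p\<close> of the tangent space is not zero: \<open>h\<close> is
  tensorial, and every tangent vector at \<open>p\<close> is the value at \<open>p\<close> of a vector field.\<close>

definition h_nonzero_set ::
  "('a, 'e::euclidean_space) atlas \<Rightarrow> 'a endo_field \<Rightarrow> 'a vfield \<Rightarrow> 'a set" where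
  "h_nonzero_set A \<phi> \<xi> = {p. \<exists>X. vector_field A X \<and> h_tensor \<phi> \<xi> X p \<noteq> 0}"

definition killing :: "('a, 'e::euclidean_space) atlas \<Rightarrow> 'a bilin_field \<Rightarrow> 'a vfield \<Rightarrow> bool" where
  "killing A g V \<longleftrightarrow> vector_field A V \<and>
     (\<forall>X Y. vector_field A X \<longrightarrow> vector_field A Y \<longrightarrow> lie_deriv_bilin V g X Y = 0)"

definition K_contact ::
  "('a::{t2_space,second_countable_topology}, 'e::euclidean_space) atlas \<Rightarrow>
     'a endo_field \<Rightarrow> 'a vfield \<Rightarrow> 'a one_form \<Rightarrow> 'a bilin_field \<Rightarrow> bool" where
  "K_contact A \<phi> \<xi> \<eta> g \<longleftrightarrow> contact_metric A \<phi> \<xi> \<eta> g \<and> killing A g \<xi>"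

text \<open>\<open>D\<close> is the Levi-Civita connection of \<open>g\<close>; the left hand side is \<open>(D\<^sub>X \<phi>) Y\<close>.\<close>

definition sasakian ::
  "('a::{t2_space,second_countable_topology}, 'e::euclidean_space) atlas \<Rightarrow>
     'a endo_field \<Rightarrow> 'a vfield \<Rightarrow> 'a one_form \<Rightarrow> 'a bilin_field \<Rightarrow>
     ('a vfield \<Rightarrow> 'a vfield \<Rightarrow> 'a vfield) \<Rightarrow> bool" where
  "sasakian A \<phi> \<xi> \<eta> g D \<longleftrightarrow> contact_metric A \<phi> \<xi> \<eta> g \<and>
     (\<forall>X Y. vector_field A X \<longrightarrow> vector_field A Y \<longrightarrow>
        D X (endo_app \<phi> Y) - endo_app \<phi> (D X Y) = bilin_app g X Y \<odot> \<xi> - form_app \<eta> Y \<odot> X)"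


section \<open>Almost Ricci--Bourguignon solitons\<close>

definition almost_RB_soliton ::
  "('a, 'e::euclidean_space) atlas \<Rightarrow> 'a bilin_field \<Rightarrow> ('a vfield \<Rightarrow> 'a vfield \<Rightarrow> 'a vfield) \<Rightarrow>
     'a vfield \<Rightarrow> ('a \<Rightarrow> real) \<Rightarrow> real \<Rightarrow> bool" where
  "almost_RB_soliton A g D V \<Lambda> \<rho> \<longleftrightarrow> vector_field A V \<and> smooth_fun A \<Lambda> \<and>
     (\<forall>X Y p. vector_field A X \<longrightarrow> vector_field A Y \<longrightarrow>
        ricci A g D X Y p + (1/2) * lie_deriv_bilin V g X Y p
          = (\<Lambda> p + \<rho> * scalar_curvature A g D p) * bilin_app g X Y p)"

definition nowhere_vanishing :: "'a vfield \<Rightarrow> bool" where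
  "nowhere_vanishing V \<longleftrightarrow> (\<forall>p. V p \<noteq> 0)"

definition pointwise_collinear ::
  "('a, 'e::euclidean_space) atlas \<Rightarrow> 'a vfield \<Rightarrow> 'a vfield \<Rightarrow> bool" where
  "pointwise_collinear A V \<xi> \<longleftrightarrow> (\<exists>f. smooth_fun A f \<and> V = f \<odot> \<xi>)"

end

theory Submission
  imports Defs
begin

text \<open>Write \<open>D\<^sub>X \<xi> = S X - \<phi> X\<close>. Then \<open>S = - \<phi> h\<close> is symmetric and anticommutes with \<open>\<phi>\<close>, and
  \<open>R(X,\<xi>)\<xi> = - (D\<^sub>\<xi> S) X - S\<^sup>2 X - \<phi>\<^sup>2 X\<close>. In dimension 3 the trace of this identity turns
  \<open>Q \<xi> = \<sigma> \<xi>\<close> into \<open>|S e|\<^sup>2 = (1 - \<sigma>/2) |e|\<^sup>2\<close> for horizontal \<open>e\<close>. For \<open>V = f \<xi>\<close> the terms of the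
  soliton equation containing derivatives of \<open>f\<close> vanish on horizontal fields, and its trace-free
  horizontal part reads \<open>D\<^sub>\<xi> S = f S\<close>. Differentiating \<open>|S e|\<^sup>2\<close> along \<open>\<xi>\<close> and using
  \<open>\<xi>(\<sigma>) = 0\<close> leaves \<open>f |S e|\<^sup>2 = 0\<close>, hence \<open>f = 0\<close> wherever \<open>h\<close> is nonzero.

  A horizontal field \<open>e\<close> satisfies
  \<open>|e|\<^sup>2 Y = g(Y,e) e + g(Y,\<phi> e) \<phi> e + |e|\<^sup>2 \<eta>(Y) \<xi>\<close> on the whole manifold, also where \<open>e\<close>
  vanishes. This replaces local frames: linearity over smooth functions suffices to evaluate tensors
  and traces. It only needs that the tangent spaces have dimension at most 3.\<close>

section \<open>Functions of class \<open>C\<^sup>k\<close>\<close>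

text \<open>The Frechet derivative at a point of an open set depends only on nearby values, so
  agreement on \<open>S\<close> passes to all iterated derivatives.\<close>

lemma C_k_on_cong:
  assumes "open S" "\<And>x. x \<in> S \<Longrightarrow> f x = g x" "C_k_on k S f"
  shows "C_k_on k S g"
  using assms(2,3)
proof (induction k arbitrary: f g)
  case 0
  then show ?case using continuous_on_cong[of S S f g] by simp
next
  case (Suc k)
  have fd: "f differentiable at x" if "x \<in> S" for x using Suc.prems that by simp
  have hd: "(g has_derivative frechet_derivative f (at x)) (at x)" if "x \<in> S" for x
    using has_derivative_transform_within_open[OF _ \<open>open S\<close> that] fd[OF that] Suc.prems(1)
      frechet_derivative_works by blast
  have eq: "frechet_derivative f (at x) = frechet_derivative g (at x)" if "x \<in> S" for x
    using frechet_derivative_at[OF hd[OF that]] by simp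
  have "C_k_on k S (\<lambda>x. frechet_derivative g (at x) v)" for v
    by (rule Suc.IH[of "\<lambda>x. frechet_derivative f (at x) v"]) (use eq Suc.prems in auto)
  then show ?case using hd by (auto simp: differentiable_def)
qed

text \<open>Lets an explicit derivative formula \<open>f'\<close> stand in for
  \<open>frechet_derivative\<close>, which turns the closure proofs below into inductions on the
  order.\<close>

lemma C_k_on_SucI:
  assumes "open S" "\<And>x. x \<in> S \<Longrightarrow> (f has_derivative f' x) (at x)"
    and "\<And>v. C_k_on k S (\<lambda>x. f' x v)"
  shows "C_k_on (Suc k) S f"
proof -
  have "f' x = frechet_derivative f (at x)" if "x \<in> S" for x
    using frechet_derivative_at[OF assms(2)[OF that]] .
  then have "C_k_on k S (\<lambda>x. frechet_derivative f (at x) v)" for v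
    by (intro C_k_on_cong[OF assms(1) _ assms(3)]) simp
  then show ?thesis using assms(2) by (auto simp: differentiable_def)
qed

lemma C_k_on_Suc_derivative:
  assumes "C_k_on (Suc k) S f" "x \<in> S"
  shows "(f has_derivative frechet_derivative f (at x)) (at x)"
  using assms by (simp flip: frechet_derivative_works)

lemma C_k_on_Suc_imp: "C_k_on (Suc k) S f \<Longrightarrow> C_k_on k S f"
proof (induction k arbitrary: f)
  case 0
  then have "f differentiable_on S"
    by (auto simp: differentiable_on_def intro: differentiable_at_withinI)
  then show ?case using differentiable_imp_continuous_on by auto
next
  case (Suc k)
  from Suc.prems have "C_k_on (Suc k) S (\<lambda>x. frechet_derivative f (at x) v)" for v
    using C_k_on.simps(2) by blast
  with Suc show ?case by (metis C_k_on.simps(2))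
qed

lemma C_k_on_imp_continuous_on: "C_k_on k S f \<Longrightarrow> continuous_on S f"
proof (induction k)
  case (Suc k)
  then show ?case using C_k_on_Suc_imp by metis
qed simp

lemma C_k_on_subset: "C_k_on k T f \<Longrightarrow> S \<subseteq> T \<Longrightarrow> C_k_on k S f"
  by (induction k arbitrary: f) (auto intro: continuous_on_subset)

text \<open>Differentiability of any order is local. This glues a cut-off function from the region
  where it is a product and the region where it is zero.\<close>

lemma C_k_on_Un:
  "open S \<Longrightarrow> open T \<Longrightarrow> C_k_on k S f \<Longrightarrow> C_k_on k T f \<Longrightarrow> C_k_on k (S \<union> T) f"
  by (induction k arbitrary: f) (auto intro: continuous_on_open_Un)

lemma C_k_on_const: "C_k_on k S (\<lambda>x. c)"
proof (induction k arbitrary: c)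
  case (Suc k)
  show ?case by (simp add: frechet_derivative_const Suc)
qed simp

lemma C_k_on_bounded_linear_compose:
  assumes "bounded_linear L" "open S" "C_k_on k S f"
  shows "C_k_on k S (\<lambda>x. L (f x))"
  using assms(3)
proof (induction k arbitrary: f)
  case 0
  then show ?case using bounded_linear.continuous_on[OF assms(1)] by simp
next
  case (Suc k)
  show ?case
  proof (rule C_k_on_SucI[OF assms(2)])
    show "((\<lambda>x. L (f x)) has_derivative (\<lambda>v. L (frechet_derivative f (at x) v))) (at x)"
      if "x \<in> S" for x
      using bounded_linear.has_derivative[OF assms(1) C_k_on_Suc_derivative[OF Suc.prems that]] .
    show "C_k_on k S (\<lambda>x. L (frechet_derivative f (at x) v))" for v
      by (rule Suc.IH) (use Suc.prems in auto)
  qed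
qed

lemma C_k_on_bounded_linear:
  assumes "bounded_linear L" "open S" shows "C_k_on k S L"
proof (cases k)
  case 0
  then show ?thesis using assms by (simp add: linear_continuous_on)
next
  case (Suc m)
  show ?thesis unfolding Suc
    by (rule C_k_on_SucI[OF assms(2)])
       (auto intro: bounded_linear_imp_has_derivative assms C_k_on_const)
qed

lemma C_k_on_add:
  assumes "open S" "C_k_on k S f" "C_k_on k S g"
  shows "C_k_on k S (\<lambda>x. f x + g x)"
  using assms(2,3)
proof (induction k arbitrary: f g)
  case 0
  then show ?case by (simp add: continuous_on_add)
next
  case (Suc k)
  show ?case
    by (rule C_k_on_SucI[OF assms(1)
          has_derivative_add[OF C_k_on_Suc_derivative[OF Suc.prems(1)] C_k_on_Suc_derivative[OF Suc.prems(2)]]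
          Suc.IH])
       (use Suc.prems in auto)
qed

lemma C_k_on_sum:
  assumes "open S" "\<And>i. i \<in> I \<Longrightarrow> C_k_on k S (f i)"
  shows "C_k_on k S (\<lambda>x. \<Sum>i\<in>I. f i x)"
  using assms(2)
  by (induction I rule: infinite_finite_induct) (auto intro: C_k_on_const C_k_on_add[OF assms(1)])

lemma C_k_on_bounded_bilinear:
  assumes "bounded_bilinear P" "open S" "C_k_on k S f" "C_k_on k S g"
  shows "C_k_on k S (\<lambda>x. P (f x) (g x))"
  using assms(3,4)
proof (induction k arbitrary: f g)
  case 0
  then show ?case using bounded_bilinear.continuous_on[OF assms(1)] by simp
next
  case (Suc k)
  \<comment> \<open>The product rule leaves one factor undifferentiated, so the induction hypothesis
    is also applied to \<open>f\<close> and \<open>g\<close> themselves at order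
    \<open>k\<close>.\<close>
  have lower: "C_k_on k S f" "C_k_on k S g" using Suc.prems C_k_on_Suc_imp by blast+
  show ?case
    by (rule C_k_on_SucI[OF assms(2)
          bounded_bilinear.FDERIV[OF assms(1) C_k_on_Suc_derivative[OF Suc.prems(1)] C_k_on_Suc_derivative[OF Suc.prems(2)]]
          C_k_on_add[OF assms(2) Suc.IH Suc.IH]])
       (use Suc.prems lower in auto)
qed

lemmas C_k_on_mult = C_k_on_bounded_bilinear[OF bounded_bilinear_mult]
lemmas C_k_on_scaleR = C_k_on_bounded_bilinear[OF bounded_bilinear_scaleR]

text \<open>The chain rule is expanded in the basis: the derivative is a finite sum of components of
  the derivative of \<open>g\<close> times partial derivatives of \<open>f\<close> composed with
  \<open>g\<close>. The induction hypothesis, general in \<open>f\<close>, covers the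
  latter.\<close>

lemma C_k_on_compose:
  fixes f :: "'d::euclidean_space \<Rightarrow> 'f::real_normed_vector"
  assumes "open S" "open T" "g ` S \<subseteq> T" "C_k_on k T f" "C_k_on k S g"
  shows "C_k_on k S (\<lambda>x. f (g x))"
  using assms(4,5)
proof (induction k arbitrary: f)
  case 0
  then show ?case using continuous_on_compose2[OF _ _ assms(3)] by auto
next
  case (Suc k)
  have "C_k_on k S (\<lambda>x. \<Sum>i\<in>Basis. (frechet_derivative g (at x) v \<bullet> i) *\<^sub>R frechet_derivative f (at (g x)) i)" for v
    by (intro C_k_on_sum C_k_on_scaleR assms Suc.IH C_k_on_bounded_linear_compose[OF bounded_linear_inner_left])
       (use Suc.prems C_k_on_Suc_imp[OF Suc.prems(2)] in auto)
  moreover have "((\<lambda>x. f (g x)) has_derivative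
      (\<lambda>v. \<Sum>i\<in>Basis. (frechet_derivative g (at x) v \<bullet> i) *\<^sub>R frechet_derivative f (at (g x)) i)) (at x)"
    if "x \<in> S" for x
  proof -
    have 1: "(f has_derivative frechet_derivative f (at (g x))) (at (g x))"
      using C_k_on_Suc_derivative[OF Suc.prems(1)] assms(3) that by auto
    interpret L: linear "frechet_derivative f (at (g x))"
      using 1 has_derivative_linear by blast
    have "(\<Sum>i\<in>Basis. (w \<bullet> i) *\<^sub>R frechet_derivative f (at (g x)) i) = frechet_derivative f (at (g x)) w" for w
      by (metis (no_types, lifting) L.scale L.sum euclidean_representation sum.cong)
    then show ?thesis
      using has_derivative_compose[OF C_k_on_Suc_derivative[OF Suc.prems(2) that] 1] by simp
  qed
  ultimately show ?case by (intro C_k_on_SucI[OF assms(1)])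
qed

section \<open>The flat function exp(-1/t), extended by zero\<close>

lemma power_mult_exp_minus_le: "0 \<le> s \<Longrightarrow> s ^ k * exp (- s) \<le> fact k" for s :: real
proof -
  assume s: "0 \<le> s"
  have "(\<Sum>i\<in>{k}. s ^ i /\<^sub>R fact i) \<le> (\<Sum>i. s ^ i /\<^sub>R fact i)"
    by (rule sum_le_suminf[OF summable_exp_generic]) (use s in auto)
  then have "s ^ k / fact k \<le> exp s"
    by (simp add: exp_def field_simps)
  then show ?thesis by (simp add: exp_minus field_simps)
qed

lemma has_real_derivative_zero_of_quadratic_bound:
  fixes f :: "real \<Rightarrow> real"
  assumes "\<And>t. \<bar>f (x + t)\<bar> \<le> C * t\<^sup>2"
  shows "(f has_real_derivative 0) (at x)"
proof -
  have fx: "f x = 0" using assms[of 0] by simp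
  have "((\<lambda>h. (f (x + h) - f x) / h) \<longlongrightarrow> 0) (at 0)"
  proof (rule Lim_null_comparison)
    show "\<forall>\<^sub>F h in at 0. norm ((f (x + h) - f x) / h) \<le> C * \<bar>h\<bar>"
    proof (rule always_eventually, rule allI)
      fix h :: real
      show "norm ((f (x + h) - f x) / h) \<le> C * \<bar>h\<bar>"
        using assms[of h] by (cases "h = 0") (simp_all add: fx divide_le_eq power2_eq_square mult.assoc)
    qed
    show "((\<lambda>h. C * \<bar>h\<bar>) \<longlongrightarrow> 0) (at 0)" by (auto intro!: tendsto_eq_intros)
  qed
  then show ?thesis by (simp add: DERIV_def)
qed

text \<open>The parameter \<open>n\<close> is there because differentiating exp(-1/t) produces
  powers of 1/t: the span of the whole family is closed under differentiation, so a single induction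
  shows that every member is smooth.\<close>

definition flat_exp :: "nat \<Rightarrow> real \<Rightarrow> real" where
  "flat_exp n t = (if t > 0 then inverse t ^ n * exp (- inverse t) else 0)"

lemma flat_exp_derivative:
  "(flat_exp n has_real_derivative (flat_exp (n + 2) t - real n * flat_exp (n + 1) t)) (at t)"
proof -
  consider "t > 0" | "t < 0" | "t = 0" by linarith
  then show ?thesis
  proof cases
    case 1
    have "((\<lambda>t. inverse t ^ n) has_real_derivative - (real n * inverse t ^ (n + 1))) (at t)"
    proof (rule DERIV_cong[OF DERIV_power[OF DERIV_inverse]])
      show "real n * (- (inverse t ^ Suc (Suc 0)) * inverse t ^ (n - Suc 0)) = - (real n * inverse t ^ (n + 1))"
        by (cases n) (simp_all del: power_inverse add: mult_ac)
    qed (use 1 in simp)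
    moreover have "((\<lambda>t. exp (- inverse t)) has_real_derivative exp (- inverse t) * inverse t ^ 2) (at t)"
      using 1 by (auto intro!: derivative_eq_intros simp: power2_eq_square)
    ultimately have "((\<lambda>t. inverse t ^ n * exp (- inverse t)) has_real_derivative
        (flat_exp (n + 2) t - real n * flat_exp (n + 1) t)) (at t)"
      using 1 by (intro DERIV_cong[OF DERIV_mult]) (auto simp: flat_exp_def algebra_simps power2_eq_square)
    then show ?thesis
      by (rule has_field_derivative_transform_within_open[of _ _ _ "{0<..}"])
        (use 1 in \<open>auto simp: flat_exp_def\<close>)
  next
    case 2
    show ?thesis
      by (rule has_field_derivative_transform_within_open[of "\<lambda>_. 0" _ _ "{..<0}"])
        (use 2 in \<open>auto simp: flat_exp_def\<close>)
  next
    case 3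
    \<comment> \<open>Two extra powers of 1/h are still dominated by the exponential. This yields a
      quadratic bound, hence derivative 0 at the origin, which is also the value of the claimed
      formula there.\<close>
    have "\<bar>flat_exp n (0 + h)\<bar> \<le> fact (n + 2) * h\<^sup>2" for h
    proof (cases "h > 0")
      case True
      then have "inverse h ^ n * exp (- inverse h) = (inverse h ^ (n + 2) * exp (- inverse h)) * h\<^sup>2"
        by (simp add: field_simps power2_eq_square)
      also have "\<dots> \<le> fact (n + 2) * h\<^sup>2"
        using power_mult_exp_minus_le[of "inverse h" "n + 2"] True
        by (intro mult_right_mono) auto
      finally show ?thesis using True by (simp add: flat_exp_def)
    qed (simp add: flat_exp_def)
    from has_real_derivative_zero_of_quadratic_bound[OF this] show ?thesis
      using 3 by (simp add: flat_exp_def[of _ 0])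
  qed
qed

lemma C_k_on_flat_exp: "C_k_on k UNIV (flat_exp n)"
proof (induction k arbitrary: n)
  case 0
  show ?case
    using DERIV_isCont[OF flat_exp_derivative[of n]] by (auto simp: continuous_on_eq_continuous_at)
next
  case (Suc k)
  show ?case
  proof (rule C_k_on_SucI)
    show "(flat_exp n has_derivative (*) (flat_exp (n + 2) t - real n * flat_exp (n + 1) t)) (at t)" for t
      using flat_exp_derivative has_field_derivative_def by blast
    have "C_k_on k UNIV (\<lambda>t. (flat_exp (n + 2) t + (- real n) * flat_exp (n + 1) t) * v)" for v
      by (intro C_k_on_mult C_k_on_add C_k_on_const Suc.IH) auto
    then show "C_k_on k UNIV (\<lambda>t. (flat_exp (n + 2) t - real n * flat_exp (n + 1) t) * v)" for v
      by simp
  qed simp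
qed

section \<open>Hadamard's lemma\<close>

lemma radial_segment_in_ball:
  fixes a :: "'e::real_normed_vector"
  assumes "x \<in> ball a r" "t \<in> {0..1}"
  shows "a + t *\<^sub>R (x - a) \<in> ball a r"
proof -
  have "\<bar>t\<bar> * norm (x - a) \<le> norm (x - a)"
    using assms(2) by (simp add: mult_left_le_one_le)
  then show ?thesis using assms(1) by (simp add: dist_norm norm_minus_commute)
qed

text \<open>Differentiating \<open>f (a + t *\<^sub>R (x - a))\<close> in \<open>x\<close> brings
  out a factor \<open>t\<close>. The weight \<open>t ^ m\<close> makes the claim stable under this,
  with \<open>m\<close> growing by one at each order.\<close>

lemma C_k_on_radial_integral:
  fixes f :: "'e::euclidean_space \<Rightarrow> real"
  assumes "C_k_on k (ball a r) f"
  shows "C_k_on k (ball a r) (\<lambda>x. integral {0..1} (\<lambda>t. t ^ m * f (a + t *\<^sub>R (x - a))))"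
  using assms
proof (induction k arbitrary: f m)
  note star = radial_segment_in_ball[of _ a r]
  have cont: "continuous_on (ball a r \<times> {0..1}) (\<lambda>(x, t). t ^ m *\<^sub>R F (a + t *\<^sub>R (x - a)))"
    if "continuous_on (ball a r) F" for F :: "'e \<Rightarrow> 'w::real_normed_vector" and m
    unfolding split_beta
    by (intro continuous_intros continuous_on_compose2[OF that]) (use star in auto)
  {
    case 0
    then show ?case
      using integral_continuous_on_param[of "ball a r" 0 1 "\<lambda>x t. t ^ m * f (a + t *\<^sub>R (x - a))"] cont[of f m]
      by simp
  next
    case (Suc k)
    have cf: "continuous_on (ball a r) f"
      using Suc.prems by (rule C_k_on_imp_continuous_on)
    let ?D = "\<lambda>y. frechet_derivative f (at y)"
    \<comment> \<open>\<open>F\<close> bundles the partial derivatives into a bounded linear map,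
      the form in which \<open>leibniz_rule\<close> takes derivatives; its continuity reduces to
      that of the partial derivatives.\<close>
    define F where "F y = (\<Sum>i\<in>Basis. ?D y i *\<^sub>R blinfun_inner_left i)" for y
    have F: "blinfun_apply (F y) v = ?D y v" if "y \<in> ball a r" for y v
    proof -
      interpret L: linear "?D y"
        using C_k_on_Suc_derivative[OF Suc.prems that] has_derivative_linear by blast
      have "?D y v = ?D y (\<Sum>i\<in>Basis. (v \<bullet> i) *\<^sub>R i)" by (simp add: euclidean_representation)
      also have "\<dots> = (\<Sum>i\<in>Basis. (v \<bullet> i) * ?D y i)" by (simp only: L.sum L.scale real_scaleR_def)
      finally show ?thesis by (simp add: F_def blinfun.sum_left blinfun.scaleR_left mult.commute)
    qed
    have ck: "C_k_on k (ball a r) (\<lambda>y. ?D y v)" for v using Suc.prems by simp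
    have cD: "continuous_on (ball a r) (\<lambda>y. ?D y v)" for v
      using C_k_on_imp_continuous_on[OF ck] .
    have cF: "continuous_on (ball a r) F"
      unfolding F_def by (intro continuous_intros cD)
    let ?fx = "\<lambda>x t. t ^ Suc m *\<^sub>R F (a + t *\<^sub>R (x - a))"
    have fx_int: "?fx x integrable_on {0..1}" if "x \<in> ball a r" for x
    proof -
      have "continuous_on {0..1} (\<lambda>t. (\<lambda>(x, t). ?fx x t) (x, t))"
        by (rule continuous_on_compose2[OF cont[OF cF, of "Suc m"]])
           (use that in \<open>auto intro!: continuous_intros\<close>)
      then show ?thesis by (intro integrable_continuous_interval) simp
    qed
    have der0: "((\<lambda>x. integral (cbox 0 1) (\<lambda>t. t ^ m * f (a + t *\<^sub>R (x - a)))) has_derivative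
        blinfun_apply (integral (cbox 0 1) (?fx x))) (at x within ball a r)" if x: "x \<in> ball a r" for x
    proof (rule leibniz_rule)
      fix x and t :: real assume xt: "x \<in> ball a r" "t \<in> cbox 0 1"
      have "((\<lambda>x. f (a + t *\<^sub>R (x - a))) has_derivative (\<lambda>v. ?D (a + t *\<^sub>R (x - a)) (t *\<^sub>R v))) (at x)"
        by (rule has_derivative_compose[where f = "\<lambda>x. a + t *\<^sub>R (x - a)" and g = f,
              OF _ C_k_on_Suc_derivative[OF Suc.prems star]])
           (use xt in \<open>auto intro!: derivative_eq_intros\<close>)
      moreover have "?D (a + t *\<^sub>R (x - a)) (t *\<^sub>R v) = t * blinfun_apply (F (a + t *\<^sub>R (x - a))) v" for v
      proof -
        have "t \<in> {0..1}" using xt(2) by simp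
        then show ?thesis
          using F[OF star[OF xt(1)], of t "t *\<^sub>R v"] by (simp only: blinfun.scaleR_right real_scaleR_def)
      qed
      ultimately have "((\<lambda>x. f (a + t *\<^sub>R (x - a))) has_derivative (\<lambda>v. t * blinfun_apply (F (a + t *\<^sub>R (x - a))) v)) (at x)"
        by (simp only:)
      then
      have "((\<lambda>x. t ^ m * f (a + t *\<^sub>R (x - a))) has_derivative (\<lambda>v. t ^ m * (t * blinfun_apply (F (a + t *\<^sub>R (x - a))) v))) (at x)"
        by (rule has_derivative_mult_right)
      moreover have "(\<lambda>v. t ^ m * (t * blinfun_apply (F (a + t *\<^sub>R (x - a))) v)) = blinfun_apply (?fx x t)"
        by (simp add: fun_eq_iff blinfun.scaleR_left)
      ultimately show "((\<lambda>x. t ^ m * f (a + t *\<^sub>R (x - a))) has_derivative blinfun_apply (?fx x t)) (at x within ball a r)"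
        by (simp only: has_derivative_at_withinI)
    next
      fix x assume "x \<in> ball a r"
      have "continuous_on {0..1} (\<lambda>t. (\<lambda>(x, t). t ^ m *\<^sub>R f (a + t *\<^sub>R (x - a))) (x, t))"
        by (rule continuous_on_compose2[OF cont[OF cf]])
           (use \<open>x \<in> ball a r\<close> in \<open>auto intro!: continuous_intros\<close>)
      then show "(\<lambda>t. t ^ m * f (a + t *\<^sub>R (x - a))) integrable_on cbox 0 1"
        by (intro integrable_continuous) simp
    next
      show "continuous_on (ball a r \<times> cbox 0 1) (\<lambda>(x, t). ?fx x t)" using cont[OF cF, of "Suc m"] by simp
    qed (use x in auto)
    have der: "((\<lambda>x. integral {0..1} (\<lambda>t. t ^ m * f (a + t *\<^sub>R (x - a)))) has_derivative
        blinfun_apply (integral {0..1} (?fx x))) (at x)" if x: "x \<in> ball a r" for x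
      using der0[OF x] at_within_open[OF x open_ball] by (simp only: box_real)
    show ?case
    proof (rule C_k_on_SucI[OF open_ball der])
      fix v
      have "blinfun_apply (integral {0..1} (?fx x)) v
          = integral {0..1} (\<lambda>t. t ^ Suc m * ?D (a + t *\<^sub>R (x - a)) v)" if "x \<in> ball a r" for x
        unfolding blinfun_apply_integral[OF fx_int[OF that]]
        by (rule integral_cong) (use F[OF star[OF that]] in \<open>simp add: blinfun.scaleR_left\<close>)
      then show "C_k_on k (ball a r) (\<lambda>x. blinfun_apply (integral {0..1} (?fx x)) v)"
        by (intro C_k_on_cong[OF open_ball _ Suc.IH[OF ck, of "Suc m" v]]) simp
    qed
  }
qed

text \<open>The fundamental theorem of calculus along the segment from \<open>a\<close> to
  \<open>x\<close>: \<open>G i\<close> is the average of the \<open>i\<close>-th partial derivative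
  over this segment.\<close>

lemma hadamard_decomposition:
  fixes f :: "'e::euclidean_space \<Rightarrow> real"
  assumes "C_inf_on (ball a r) f"
  obtains G where "\<And>i. C_inf_on (ball a r) (G i)"
    and "\<And>x. x \<in> ball a r \<Longrightarrow> f x = f a + (\<Sum>i\<in>Basis. ((x - a) \<bullet> i) * G i x)"
proof
  let ?D = "\<lambda>y. frechet_derivative f (at y)"
  \<comment> \<open>The factor \<open>t ^ 0\<close> keeps the integrand in the shape of
    \<open>C_k_on_radial_integral\<close>.\<close>
  let ?G = "\<lambda>i x. integral {0..1} (\<lambda>t. t ^ 0 * ?D (a + t *\<^sub>R (x - a)) i)"
  have f: "C_k_on k (ball a r) f" for k using assms by (simp add: C_inf_on_def)
  have CD: "C_k_on k (ball a r) (\<lambda>x. ?D x v)" for k v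
    using f[of "Suc k"] by simp
  show "C_inf_on (ball a r) (?G i)" for i
    unfolding C_inf_on_def by (intro allI C_k_on_radial_integral CD)
  fix x assume x: "x \<in> ball a r"
  note star = radial_segment_in_ball[OF x]
  note f1 = f[of "Suc 0"]
  have "((\<lambda>t. ?D (a + t *\<^sub>R (x - a)) (x - a)) has_integral
      (f (a + 1 *\<^sub>R (x - a)) - f (a + 0 *\<^sub>R (x - a)))) {0..1}"
  proof (rule fundamental_theorem_of_calculus)
    fix t :: real assume t: "t \<in> {0..1}"
    have d: "(f has_derivative ?D (a + t *\<^sub>R (x - a))) (at (a + t *\<^sub>R (x - a)))"
      by (rule C_k_on_Suc_derivative[OF f1 star[OF t]])
    interpret L: linear "?D (a + t *\<^sub>R (x - a))" using d has_derivative_linear by blast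
    have "((\<lambda>t. f (a + t *\<^sub>R (x - a))) has_derivative (\<lambda>s. ?D (a + t *\<^sub>R (x - a)) (s *\<^sub>R (x - a)))) (at t)"
      by (rule has_derivative_compose[where f = "\<lambda>t. a + t *\<^sub>R (x - a)" and g = f, OF _ d]) (auto intro!: derivative_eq_intros)
    then show "((\<lambda>t. f (a + t *\<^sub>R (x - a))) has_vector_derivative ?D (a + t *\<^sub>R (x - a)) (x - a)) (at t within {0..1})"
      unfolding has_vector_derivative_def L.scale by (rule has_derivative_at_withinI)
  qed simp
  from integral_unique[OF this]
  have "f x - f a = integral {0..1} (\<lambda>t. ?D (a + t *\<^sub>R (x - a)) (x - a))"
    by simp
  also have "\<dots> = integral {0..1} (\<lambda>t. \<Sum>i\<in>Basis. ((x - a) \<bullet> i) * ?D (a + t *\<^sub>R (x - a)) i)"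
  proof (rule integral_cong)
    fix t :: real assume t: "t \<in> {0..1}"
    interpret L: linear "?D (a + t *\<^sub>R (x - a))"
      using C_k_on_Suc_derivative[OF f1 star[OF t]] has_derivative_linear by blast
    have "?D (a + t *\<^sub>R (x - a)) (x - a) = ?D (a + t *\<^sub>R (x - a)) (\<Sum>i\<in>Basis. ((x - a) \<bullet> i) *\<^sub>R i)"
      by (simp add: euclidean_representation)
    also have "\<dots> = (\<Sum>i\<in>Basis. ((x - a) \<bullet> i) * ?D (a + t *\<^sub>R (x - a)) i)"
      by (simp only: L.sum L.scale real_scaleR_def)
    finally show "?D (a + t *\<^sub>R (x - a)) (x - a) = \<dots>" .
  qed
  also have "\<dots> = (\<Sum>i\<in>Basis. ((x - a) \<bullet> i) * ?G i x)"
  proof -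
    have "(\<lambda>t. ?D (a + t *\<^sub>R (x - a)) i) integrable_on {0..1}" for i
    proof (rule integrable_continuous_interval)
      have "continuous_on (ball a r) (\<lambda>y. ?D y i)"
        using CD[of 0 i] by simp
      then show "continuous_on {0..1} (\<lambda>t. ?D (a + t *\<^sub>R (x - a)) i)"
        by (rule continuous_on_compose2) (auto intro!: continuous_intros star)
    qed
    then show ?thesis by (subst integral_sum) (auto intro: integrable_on_mult_right)
  qed
  finally show "f x = f a + (\<Sum>i\<in>Basis. ((x - a) \<bullet> i) * ?G i x)" by simp
qed

section \<open>Tangent spaces\<close>

lemma scaleR_fun_apply [simp]: "(c *\<^sub>R f) x = c *\<^sub>R f x"
  by (simp add: scaleR_fun_def)

lemma smooth_atlas_chart:
  assumes "smooth_atlas A" "(U, \<psi>) \<in> A"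
  shows "open U" "open (\<psi> ` U)" "inj_on \<psi> U" "continuous_on U \<psi>" "continuous_on (\<psi> ` U) (inv_into U \<psi>)"
    and "\<And>W. open W \<Longrightarrow> W \<subseteq> U \<Longrightarrow> open (\<psi> ` W)"
proof -
  obtain \<psi>' where \<psi>': "homeomorphism U (\<psi> ` U) \<psi> \<psi>'" and o: "open U" "open (\<psi> ` U)"
    using assms unfolding smooth_atlas_def by blast
  then show "open U" "open (\<psi> ` U)" "continuous_on U \<psi>"
    by (auto simp: homeomorphism_cont1)
  show inj: "inj_on \<psi> U" using \<psi>' by (metis homeomorphism_apply1 inj_onI)
  have "inv_into U \<psi> y = \<psi>' y" if "y \<in> \<psi> ` U" for y
    using \<psi>' inj that by (auto simp: homeomorphism_apply1)
  then show "continuous_on (\<psi> ` U) (inv_into U \<psi>)"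
    using homeomorphism_cont2[OF \<psi>'] continuous_on_cong by metis
  show "open (\<psi> ` W)" if "open W" "W \<subseteq> U" for W
  proof -
    have "openin (top_of_set (\<psi> ` U)) (\<psi> ` W)"
      using homeomorphism_imp_open_map[OF \<psi>'] that by (meson open_subset)
    then show ?thesis using o openin_open_trans by blast
  qed
qed

lemma smooth_atlas_obtain_chart:
  assumes "smooth_atlas A"
  obtains U \<psi> where "(U, \<psi>) \<in> A" "p \<in> U"
  using assms unfolding smooth_atlas_def by blast

section \<open>Smooth functions on a manifold and cut-offs\<close>

lemma smooth_fun_const: "smooth_fun A (\<lambda>_. c)"
  by (auto simp: smooth_fun_def C_inf_on_def o_def C_k_on_const)

lemma smooth_fun_add:
  assumes "smooth_atlas A" "smooth_fun A f" "smooth_fun A h"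
  shows "smooth_fun A (\<lambda>p. f p + h p)"
  using assms smooth_atlas_chart(2)[OF assms(1)]
  by (auto simp: smooth_fun_def C_inf_on_def o_def intro!: C_k_on_add)

lemma smooth_fun_mult:
  assumes "smooth_atlas A" "smooth_fun A f" "smooth_fun A h"
  shows "smooth_fun A (\<lambda>p. f p * h p)"
  using assms smooth_atlas_chart(2)[OF assms(1)]
  by (auto simp: smooth_fun_def C_inf_on_def o_def intro!: C_k_on_mult)

lemma smooth_fun_sum:
  assumes "smooth_atlas A" "\<And>i. i \<in> I \<Longrightarrow> smooth_fun A (f i)"
  shows "smooth_fun A (\<lambda>p. \<Sum>i\<in>I. f i p)"
  using assms(2)
  by (induction I rule: infinite_finite_induct) (auto intro: smooth_fun_const smooth_fun_add[OF assms(1)])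

lemma smooth_fun_uminus:
  assumes "smooth_atlas A" "smooth_fun A f"
  shows "smooth_fun A (\<lambda>p. - f p)"
  using smooth_fun_mult[OF assms(1) smooth_fun_const[of A "-1"] assms(2)] by simp

lemma smooth_fun_diff:
  assumes "smooth_atlas A" "smooth_fun A f" "smooth_fun A h"
  shows "smooth_fun A (\<lambda>p. f p - h p)"
  using smooth_fun_add[OF assms(1,2) smooth_fun_uminus[OF assms(1,3)]] by simp

lemma smooth_fun_continuous:
  assumes "smooth_atlas A" "smooth_fun A f"
  shows "continuous_on UNIV f"
proof (rule continuous_at_imp_continuous_on, rule ballI)
  fix p
  obtain U \<psi> where U: "(U, \<psi>) \<in> A" "p \<in> U" using smooth_atlas_obtain_chart[OF assms(1)] .
  note chart = smooth_atlas_chart[OF assms(1) U(1)]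
  have "C_k_on 0 (\<psi> ` U) (f \<circ> inv_into U \<psi>)"
    using assms(2) U(1) unfolding smooth_fun_def C_inf_on_def by fast
  then have "continuous_on U ((f \<circ> inv_into U \<psi>) \<circ> \<psi>)"
    using continuous_on_compose[OF chart(4)] by simp
  moreover have "((f \<circ> inv_into U \<psi>) \<circ> \<psi>) q = f q" if "q \<in> U" for q
    using that chart(3) by simp
  ultimately have "continuous_on U f" using continuous_on_cong by metis
  then show "isCont f p" using U(2) chart(1) continuous_on_eq_continuous_at by blast
qed

text \<open>A second chart domain \<open>W\<close> is covered by \<open>W \<inter> U\<close>, where
  the transition map is smooth, and \<open>W - C\<close>, where the function is zero. The compact
  set \<open>C\<close> is closed because the space is Hausdorff, so both pieces are open.\<close>

lemma smooth_fun_extend_by_zero: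
  fixes A :: "('a::{t2_space,second_countable_topology}, 'e::euclidean_space) atlas"
  assumes A: "smooth_atlas A" and U: "(U, \<psi>) \<in> A" and K: "compact K" "K \<subseteq> \<psi> ` U"
    and H: "C_inf_on UNIV H" "\<And>x. x \<notin> K \<Longrightarrow> H x = 0"
  shows "smooth_fun A (\<lambda>q. if q \<in> U then H (\<psi> q) else 0)"
  unfolding smooth_fun_def C_inf_on_def
proof (intro ballI allI, clarify)
  fix W \<theta> k assume W: "(W, \<theta>) \<in> A"
  note chart = smooth_atlas_chart[OF A U] and chartW = smooth_atlas_chart[OF A W]
  define C where "C = inv_into U \<psi> ` K"
  have "compact C"
    unfolding C_def by (rule compact_continuous_image[OF continuous_on_subset[OF chart(5) K(2)] K(1)])
  then have "open (W - C)" using chartW(1) compact_imp_closed by blast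
  let ?F = "(\<lambda>q. if q \<in> U then H (\<psi> q) else 0) \<circ> inv_into W \<theta>"
  have o: "open (\<theta> ` (W \<inter> U))" "open (\<theta> ` (W - C))"
    using chartW(6) \<open>open (W - C)\<close> chartW(1) chart(1) by auto
  have 1: "C_k_on k (\<theta> ` (W \<inter> U)) ?F"
  proof (rule C_k_on_cong[OF o(1)])
    show "C_k_on k (\<theta> ` (W \<inter> U)) (\<lambda>x. H ((\<psi> \<circ> inv_into W \<theta>) x))"
    proof (rule C_k_on_compose[OF o(1) open_UNIV, where g = "\<psi> \<circ> inv_into W \<theta>"])
      show "C_k_on k (\<theta> ` (W \<inter> U)) (\<psi> \<circ> inv_into W \<theta>)"
        using A U W unfolding smooth_atlas_def C_inf_on_def by fast
    qed (use H(1) in \<open>auto simp: C_inf_on_def\<close>)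
  qed (use chartW(3) in auto)
  have 2: "C_k_on k (\<theta> ` (W - C)) ?F"
  proof (rule C_k_on_cong[OF o(2) _ C_k_on_const[of _ _ 0]])
    fix x assume "x \<in> \<theta> ` (W - C)"
    then obtain q where q: "q \<in> W" "q \<notin> C" "x = \<theta> q" by auto
    have "\<psi> q \<notin> K" if "q \<in> U"
      using q(2) that chart(3) by (metis C_def image_eqI inv_into_f_f)
    then show "0 = ?F x" using q chartW(3) H(2) by simp
  qed
  have "C \<subseteq> U" using K(2) by (auto simp: C_def inv_into_into)
  then have "\<theta> ` W = \<theta> ` (W \<inter> U) \<union> \<theta> ` (W - C)" by auto
  then show "C_k_on k (\<theta> ` W) ?F" using C_k_on_Un[OF o 1 2] by simp
qed

text \<open>\<open>flat_exp 0\<close> applied to s^2 - |x - a|^2 is positive inside the ball and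
  zero outside; dividing by its value at the centre normalises it.\<close>

lemma bump_function_exists:
  fixes a :: "'e::euclidean_space"
  assumes "0 < s"
  obtains b :: "'e \<Rightarrow> real" where "C_inf_on UNIV b" "b a = 1" "\<And>x. x \<notin> cball a s \<Longrightarrow> b x = 0"
proof
  let ?b = "\<lambda>x. flat_exp 0 (s\<^sup>2 + (-1) * ((x - a) \<bullet> (x - a))) * inverse (flat_exp 0 (s\<^sup>2))"
  have "C_k_on k UNIV (\<lambda>x. x + - a)" for k
    by (rule C_k_on_add[OF open_UNIV C_k_on_bounded_linear[OF bounded_linear_ident open_UNIV] C_k_on_const])
  then have "C_k_on k UNIV (\<lambda>x. x - a)" for k by simp
  then have "C_k_on k UNIV (\<lambda>x. (x - a) \<bullet> (x - a))" for k
    by (intro C_k_on_bounded_bilinear[OF bounded_bilinear_inner open_UNIV])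
  then have "C_k_on k UNIV (\<lambda>x. s\<^sup>2 + (-1) * ((x - a) \<bullet> (x - a)))" for k
    by (intro C_k_on_add[OF open_UNIV] C_k_on_mult[OF open_UNIV] C_k_on_const)
  then have "C_k_on k UNIV (\<lambda>x. flat_exp 0 (s\<^sup>2 + (-1) * ((x - a) \<bullet> (x - a))))" for k
    by (rule C_k_on_compose[OF open_UNIV open_UNIV subset_UNIV C_k_on_flat_exp])
  then show "C_inf_on UNIV ?b"
    unfolding C_inf_on_def by (intro allI C_k_on_mult[OF open_UNIV] C_k_on_const)
  show "?b a = 1" using assms by (simp add: flat_exp_def)
  show "?b x = 0" if "x \<notin> cball a s" for x
  proof -
    have "s\<^sup>2 \<le> (norm (x - a))\<^sup>2" using that assms by (intro power_mono) (auto simp: dist_norm norm_minus_commute)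
    then show ?thesis by (simp add: flat_exp_def power2_norm_eq_inner)
  qed
qed

text \<open>The product is smooth on \<open>ball a r\<close> and zero off \<open>cball a s\<close>;
  since \<open>s < r\<close>, these two open sets cover the space.\<close>

lemma C_inf_on_bump_mult:
  assumes b: "C_inf_on UNIV b" "\<And>x. x \<notin> cball a s \<Longrightarrow> b x = 0" and "s < r" and G: "C_inf_on (ball a r) G"
  shows "C_inf_on UNIV (\<lambda>x. b x * (if x \<in> ball a r then G x else 0 :: real))"
  unfolding C_inf_on_def
proof
  fix k
  let ?h = "\<lambda>x. b x * (if x \<in> ball a r then G x else 0)"
  have "C_k_on k (ball a r) ?h"
  proof (rule C_k_on_cong[OF open_ball])
    show "C_k_on k (ball a r) (\<lambda>x. b x * G x)"
      using b(1) G C_k_on_subset[of k UNIV b] by (auto simp: C_inf_on_def intro!: C_k_on_mult)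
  qed simp
  moreover have "C_k_on k (- cball a s) ?h"
    by (rule C_k_on_cong[OF _ _ C_k_on_const[of _ _ 0]]) (use b(2) in auto)
  moreover have "ball a r \<union> - cball a s = UNIV" using \<open>s < r\<close> by auto
  ultimately show "C_k_on k UNIV ?h"
    using C_k_on_Un[of "ball a r" "- cball a s" k ?h] by (simp add: open_Compl)
qed

section \<open>Tangent vectors as derivations\<close>

lemma tangent_space_add: "v \<in> tangent_space A p \<Longrightarrow> smooth_fun A f \<Longrightarrow> smooth_fun A h \<Longrightarrow> v (\<lambda>q. f q + h q) = v f + v h"
  and tangent_space_scale: "v \<in> tangent_space A p \<Longrightarrow> smooth_fun A f \<Longrightarrow> v (\<lambda>q. c * f q) = c * v f"
  and tangent_space_mult: "v \<in> tangent_space A p \<Longrightarrow> smooth_fun A f \<Longrightarrow> smooth_fun A h \<Longrightarrow>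
        v (\<lambda>q. f q * h q) = f p * v h + h p * v f"
  and tangent_space_non_smooth: "v \<in> tangent_space A p \<Longrightarrow> \<not> smooth_fun A f \<Longrightarrow> v f = 0"
  by (simp_all add: tangent_space_def plus_fun_def times_fun_def scaleR_fun_def)

lemma tangent_space_zero_fun: "v \<in> tangent_space A p \<Longrightarrow> v (\<lambda>_. 0) = 0"
  using tangent_space_scale[of v A p "\<lambda>_. 0" 0] smooth_fun_const[of A 0] by simp

lemma tangent_space_const:
  assumes "v \<in> tangent_space A p"
  shows "v (\<lambda>_. c) = 0"
  using tangent_space_mult[OF assms smooth_fun_const[of A 1] smooth_fun_const[of A 1]]
    tangent_space_scale[OF assms smooth_fun_const[of A 1], of c] by simp

lemma tangent_space_diff:
  assumes "smooth_atlas A" "v \<in> tangent_space A p" "smooth_fun A f" "smooth_fun A h"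
  shows "v (\<lambda>q. f q - h q) = v f - v h"
  using tangent_space_add[OF assms(2,3), of "\<lambda>q. (-1) * h q"] tangent_space_scale[OF assms(2,4), of "-1"]
    smooth_fun_uminus[OF assms(1,4)] by simp

lemma tangent_space_sum:
  assumes "smooth_atlas A" "v \<in> tangent_space A p" "\<And>i. i \<in> I \<Longrightarrow> smooth_fun A (f i)"
  shows "v (\<lambda>q. \<Sum>i\<in>I. f i q) = (\<Sum>i\<in>I. v (f i))"
  using assms(3)
proof (induction I rule: infinite_finite_induct)
  case (insert i I)
  then show ?case
    using tangent_space_add[OF assms(2), of "f i" "\<lambda>q. \<Sum>i\<in>I. f i q"] smooth_fun_sum[OF assms(1), of I f] by simp
qed (simp_all add: tangent_space_zero_fun[OF assms(2)])

lemma subspace_tangent_space: "subspace (tangent_space A p)"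
  unfolding subspace_def tangent_space_def by (auto simp: algebra_simps)

text \<open>The functions below are the chart coordinates around \<open>p\<close>, cut off by a bump function \<open>b\<close>.
  Multiplying Hadamard's decomposition of \<open>f\<close> by \<open>b\<^sup>2\<close> turns it into an identity between globally
  smooth functions, so the locality of derivations is not needed.\<close>

lemma tangent_space_separating_functions:
  fixes A :: "('a::{t2_space,second_countable_topology}, 'e::euclidean_space) atlas"
  assumes A: "smooth_atlas A"
  obtains y :: "'e \<Rightarrow> 'a \<Rightarrow> real"
  where "\<And>v. v \<in> tangent_space A p \<Longrightarrow> \<forall>i\<in>Basis. v (y i) = 0 \<Longrightarrow> v = 0"
proof -
  obtain U \<psi> where U: "(U, \<psi>) \<in> A" "p \<in> U" using smooth_atlas_obtain_chart[OF A] .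
  note chart = smooth_atlas_chart[OF A U(1)]
  define a where "a = \<psi> p"
  obtain r where r: "r > 0" "ball a r \<subseteq> \<psi> ` U"
    using chart(2) U(2) unfolding a_def by (meson image_eqI openE)
  define s where "s = r / 2"
  have s: "0 < s" "s < r" using r by (auto simp: s_def)
  obtain b :: "'e \<Rightarrow> real" where b: "C_inf_on UNIV b" "b a = 1" "\<And>x. x \<notin> cball a s \<Longrightarrow> b x = 0"
    using bump_function_exists[OF s(1)] by blast
  define pull where "pull G = (\<lambda>q. if q \<in> U then b (\<psi> q) * (if \<psi> q \<in> ball a r then G (\<psi> q) else 0) else 0)"
    for G :: "'e \<Rightarrow> real"
  have pull: "smooth_fun A (pull G)" if "C_inf_on (ball a r) G" for G
  proof -
    have "cball a s \<subseteq> \<psi> ` U" using r(2) s(2) by (auto simp: subset_iff)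
    then show ?thesis
      unfolding pull_def
      using smooth_fun_extend_by_zero[OF A U(1) compact_cball _ C_inf_on_bump_mult[OF b(1,3) s(2) that]] b(3)
      by simp
  qed
  have coord: "C_inf_on (ball a r) (\<lambda>x. (x - a) \<bullet> i)" for i
  proof -
    have "C_k_on k (ball a r) (\<lambda>x. x \<bullet> i + - (a \<bullet> i))" for k
      by (intro C_k_on_add C_k_on_const C_k_on_bounded_linear bounded_linear_inner_left open_ball)
    then show ?thesis by (simp add: C_inf_on_def inner_diff_left)
  qed
  define y where "y i = pull (\<lambda>x. (x - a) \<bullet> i)" for i
  have y: "smooth_fun A (y i)" for i unfolding y_def by (rule pull[OF coord])
  define \<beta> where "\<beta> = pull (\<lambda>_. 1)"
  have \<beta>: "smooth_fun A \<beta>" unfolding \<beta>_def by (rule pull) (simp add: C_inf_on_def C_k_on_const)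
  have p: "\<beta> p = 1" "y i p = 0" for i
    using U(2) r b(2) by (auto simp: \<beta>_def y_def pull_def a_def)
  show ?thesis
  proof
    fix v assume v: "v \<in> tangent_space A p" and vy: "\<forall>i\<in>Basis. v (y i) = 0"
    have "v f = 0" if f: "smooth_fun A f" for f
    proof -
      have "C_inf_on (\<psi> ` U) (f \<circ> inv_into U \<psi>)"
        using f U(1) unfolding smooth_fun_def by fast
      then have "C_inf_on (ball a r) (f \<circ> inv_into U \<psi>)"
        unfolding C_inf_on_def using C_k_on_subset r(2) by blast
      then obtain G where G: "\<And>i. C_inf_on (ball a r) (G i)"
        "\<And>x. x \<in> ball a r \<Longrightarrow> (f \<circ> inv_into U \<psi>) x = (f \<circ> inv_into U \<psi>) a + (\<Sum>i\<in>Basis. ((x - a) \<bullet> i) * G i x)"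
        using hadamard_decomposition[of a r "f \<circ> inv_into U \<psi>"] by blast
      define w where "w i = pull (G i)" for i
      have w: "smooth_fun A (w i)" for i unfolding w_def by (rule pull[OF G(1)])
      have eq: "(\<lambda>q. (\<beta> q * \<beta> q) * f q) = (\<lambda>q. f p * (\<beta> q * \<beta> q) + (\<Sum>i\<in>Basis. y i q * w i q))"
      proof
        fix q
        show "(\<beta> q * \<beta> q) * f q = f p * (\<beta> q * \<beta> q) + (\<Sum>i\<in>Basis. y i q * w i q)"
        proof (cases "q \<in> U \<and> \<psi> q \<in> ball a r")
          case True
          then have "f q = f p + (\<Sum>i\<in>Basis. ((\<psi> q - a) \<bullet> i) * G i (\<psi> q))"
            using G(2)[of "\<psi> q"] chart(3) U(2) by (simp add: a_def)
          then show ?thesis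
            using True by (simp add: \<beta>_def y_def w_def pull_def algebra_simps sum_distrib_left)
        next
          case False
          then show ?thesis by (auto simp: \<beta>_def y_def w_def pull_def)
        qed
      qed
      note sm = smooth_fun_mult[OF A] smooth_fun_add[OF A] smooth_fun_sum[OF A] smooth_fun_const \<beta> y w f
      \<comment> \<open>Leibniz rule at \<open>p\<close> with \<open>\<beta> p = 1\<close> and
        \<open>y i p = 0\<close>: the multiples of \<open>f p\<close> on both sides cancel, and
        \<open>v f\<close> is left as a combination of the numbers \<open>v (y i)\<close>.\<close>
      have "v (\<lambda>q. (\<beta> q * \<beta> q) * f q) = v f + f p * v (\<lambda>q. \<beta> q * \<beta> q)"
        by (subst tangent_space_mult[OF v]) (auto intro!: sm simp: p)
      moreover have "v (\<lambda>q. f p * (\<beta> q * \<beta> q) + (\<Sum>i\<in>Basis. y i q * w i q))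
          = f p * v (\<lambda>q. \<beta> q * \<beta> q) + (\<Sum>i\<in>Basis. v (\<lambda>q. y i q * w i q))"
        by (subst tangent_space_add[OF v]) (auto intro!: sm simp: tangent_space_scale[OF v] tangent_space_sum[OF A v] sm)
      moreover have "v (\<lambda>q. y i q * w i q) = 0" if "i \<in> Basis" for i
        by (subst tangent_space_mult[OF v]) (use vy that in \<open>auto intro!: sm simp: p\<close>)
      ultimately show ?thesis using eq by simp
    qed
    then show "v = 0" using tangent_space_non_smooth[OF v] by (auto simp: fun_eq_iff)
  qed
qed

text \<open>Recording the values of a derivation on the separating functions is a linear map into
  the model space that is injective on the tangent space, so it preserves independence.\<close>

lemma independent_tangent_space_card:
  fixes A :: "('a::{t2_space,second_countable_topology}, 'e::euclidean_space) atlas"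
  assumes "smooth_atlas A" "B \<subseteq> tangent_space A p" "independent B"
  shows "card B \<le> DIM('e)"
proof -
  obtain y :: "'e \<Rightarrow> 'a \<Rightarrow> real"
    where y: "\<And>v. v \<in> tangent_space A p \<Longrightarrow> \<forall>i\<in>Basis. v (y i) = 0 \<Longrightarrow> v = 0"
    using tangent_space_separating_functions[OF assms(1)] by blast
  define L where "L v = (\<Sum>i\<in>Basis. v (y i) *\<^sub>R i)" for v :: "'a tangent"
  have L: "linear L"
    by (rule linearI) (simp_all add: L_def scaleR_add_left sum.distrib scaleR_sum_right)
  have sp: "span B \<subseteq> tangent_space A p"
    by (rule span_minimal[OF assms(2) subspace_tangent_space])
  have inj: "inj_on L (span B)"
  proof (rule inj_onI)
    fix v w assume vw: "v \<in> span B" "w \<in> span B" "L v = L w"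
    then have "L (v - w) = 0" by (simp add: linear_diff[OF L])
    moreover have "L z \<bullet> i = z (y i)" if "i \<in> Basis" for z i
      using that by (simp add: L_def)
    ultimately have "\<forall>i\<in>Basis. (v - w) (y i) = 0" by (metis inner_zero_left)
    moreover have "v - w \<in> tangent_space A p" using sp vw span_diff by blast
    ultimately show "v = w" using y[of "v - w"] by simp
  qed
  have "independent (L ` B)"
    by (rule linear_independent_injective_image[OF L assms(3) inj])
  then have "card (L ` B) \<le> DIM('e)" using independent_bound by blast
  moreover have "inj_on L B" using inj inj_on_subset span_superset by metis
  ultimately show ?thesis by (simp add: card_image)
qed

text \<open>Otherwise the difference \<open>w\<close> between \<open>v\<close> and its expansion is
  nonzero and orthogonal to every \<open>E i p\<close>. Together these are
  \<open>DIM('e) + 1\<close> nonzero, pairwise orthogonal, hence independent vectors, against the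
  dimension bound.\<close>

lemma orthonormal_tangent_expansion:
  fixes A :: "('a::{t2_space,second_countable_topology}, 'e::euclidean_space) atlas"
  assumes "smooth_atlas A" "riemannian_metric A g" "orthonormal_at A g p E" "v \<in> tangent_space A p"
  shows "v = (\<Sum>i<DIM('e). g p v (E i p) *\<^sub>R E i p)"
proof (rule ccontr)
  assume ne: "\<not> ?thesis"
  let ?T = "tangent_space A p"
  have lin: "g p u (c *\<^sub>R w) = c * g p u w" "g p u (w + z) = g p u w + g p u z"
    if "u \<in> ?T" "w \<in> ?T" "z \<in> ?T" for c u w z
    using assms(2) that by (auto simp: riemannian_metric_def linear_on_space_def)
  have sym: "g p u w = g p w u" if "u \<in> ?T" "w \<in> ?T" for u w
    using assms(2) that by (auto simp: riemannian_metric_def)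
  have pos: "g p u u > 0" if "u \<in> ?T" "u \<noteq> 0" for u
    using assms(2) that by (auto simp: riemannian_metric_def)
  note sub = subspace_tangent_space[of A p]
  have g0: "g p u 0 = 0" if "u \<in> ?T" for u
    using lin(1)[OF that that that, of 0] by simp
  have gsum: "g p u (\<Sum>i\<in>I. c i *\<^sub>R w i) = (\<Sum>i\<in>I. c i * g p u (w i))"
    if "u \<in> ?T" "\<And>i. i \<in> I \<Longrightarrow> w i \<in> ?T" for u and I :: "'z set" and c w
    using that(2)
  proof (induction I rule: infinite_finite_induct)
    case (insert i I)
    have "(\<Sum>i\<in>I. c i *\<^sub>R w i) \<in> ?T"
      using insert by (auto intro!: subspace_sum[OF sub] subspace_scale[OF sub])
    moreover have w: "w i \<in> ?T" using insert.prems by simp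
    ultimately show ?case
      using insert lin(2)[OF that(1) subspace_scale[OF sub w]] lin(1)[OF that(1) w w]
      by (simp only: sum.insert insert_iff simp_thms)
  qed (simp_all add: g0[OF that(1)])
  have E: "E i p \<in> ?T" if "i < DIM('e)" for i
    using assms(3) that by (auto simp: orthonormal_at_def vector_field_def)
  have EE: "g p (E i p) (E j p) = (if i = j then 1 else 0)" if "i < DIM('e)" "j < DIM('e)" for i j
    using assms(3) that by (auto simp: orthonormal_at_def)
  define w where "w = v + (\<Sum>i<DIM('e). (- g p v (E i p)) *\<^sub>R E i p)"
  have sT: "(\<Sum>i<DIM('e). (- g p v (E i p)) *\<^sub>R E i p) \<in> ?T"
    by (auto intro!: subspace_sum[OF sub] subspace_scale[OF sub] subspace_neg[OF sub] E)
  then have w: "w \<in> ?T" unfolding w_def by (rule subspace_add[OF sub assms(4)])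
  have w0: "w \<noteq> 0" using ne by (auto simp: w_def sum_negf)
  have wE: "g p (E j p) w = 0" if "j < DIM('e)" for j
  proof -
    have "g p (E j p) w = g p (E j p) v + (\<Sum>i<DIM('e). (- g p v (E i p)) * g p (E j p) (E i p))"
      unfolding w_def lin(2)[OF E[OF that] assms(4) sT] by (subst gsum[OF E[OF that]]) (auto intro: E)
    also have "(\<Sum>i<DIM('e). (- g p v (E i p)) * g p (E j p) (E i p)) = (\<Sum>i<DIM('e). if i = j then - g p v (E i p) else 0)"
      by (rule sum.cong) (use EE that in auto)
    finally have "g p (E j p) w = g p (E j p) v - g p v (E j p)" using that by simp
    then show ?thesis using sym[OF E assms(4)] that by simp
  qed
  let ?B = "insert w ((\<lambda>i. E i p) ` {..<DIM('e)})"
  have BT: "?B \<subseteq> ?T" using w E by auto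
  have gE: "g p (E i p) (E i p) \<noteq> 0" if "i < DIM('e)" for i using EE[OF that that] by simp
  have orth: "g p x y = 0" if "x \<in> ?B" "y \<in> ?B" "x \<noteq> y" for x y
  proof -
    consider "x = w" "y \<in> (\<lambda>i. E i p) ` {..<DIM('e)}" | "y = w" "x \<in> (\<lambda>i. E i p) ` {..<DIM('e)}"
      | i j where "x = E i p" "y = E j p" "i < DIM('e)" "j < DIM('e)"
      using \<open>x \<in> ?B\<close> \<open>y \<in> ?B\<close> \<open>x \<noteq> y\<close> by blast
    then show ?thesis
    proof cases
      case 1
      then show ?thesis using wE sym[OF w] E by fastforce
    next
      case 2
      then show ?thesis using wE by auto
    next
      case 3
      then show ?thesis using EE \<open>x \<noteq> y\<close> by auto
    qed
  qed
  have nz: "x \<noteq> 0" if xB: "x \<in> ?B" for x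
  proof (cases "x = w")
    case False
    then obtain i where i: "x = E i p" "i < DIM('e)" using xB by blast
    then show ?thesis using gE[OF i(2)] g0[OF E[OF i(2)]] by metis
  qed (use w0 in simp)
  have "independent ?B"
  proof
    assume "dependent ?B"
    then obtain c x where x: "x \<in> ?B" and cx: "c x \<noteq> 0" and s0: "(\<Sum>y\<in>?B. c y *\<^sub>R y) = 0"
      using dependent_finite[of ?B] by auto
    have "0 = g p x (\<Sum>y\<in>?B. c y *\<^sub>R y)" using s0 g0 BT x by auto
    also have "\<dots> = (\<Sum>y\<in>?B. c y * g p x y)" by (rule gsum) (use BT x in auto)
    also have "\<dots> = (\<Sum>y\<in>?B. if y = x then c x * g p x x else 0)"
      by (rule sum.cong) (use orth x in auto)
    also have "\<dots> = c x * g p x x" using x by (subst sum.delta) (simp_all only: finite_insert finite_imageI finite_lessThan if_True)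
    finally have "c x * g p x x = 0" by simp
    moreover have "g p x x > 0" using pos[OF subsetD[OF BT x] nz[OF x]] .
    ultimately show False using cx by simp
  qed
  from independent_tangent_space_card[OF assms(1) BT this] have card_le: "card ?B \<le> DIM('e)" .
  have "inj_on (\<lambda>i. E i p) {..<DIM('e)}"
  proof (rule inj_onI, rule ccontr)
    fix i j assume ij: "i \<in> {..<DIM('e)}" "j \<in> {..<DIM('e)}" "E i p = E j p" "i \<noteq> j"
    then have "g p (E i p) (E j p) = 0" using EE[of i j] by simp
    then show False using ij gE[of i] by simp
  qed
  then have "card ((\<lambda>i. E i p) ` {..<DIM('e)}) = DIM('e)" by (simp add: card_image)
  moreover have "w \<notin> (\<lambda>i. E i p) ` {..<DIM('e)}"
  proof
    assume "w \<in> (\<lambda>i. E i p) ` {..<DIM('e)}"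
    then obtain i where "w = E i p" "i < DIM('e)" by blast
    then show False using wE[of i] gE[of i] by simp
  qed
  ultimately have "card ?B = Suc DIM('e)"
    by (simp only: card_insert_disjoint finite_imageI finite_lessThan not_False_eq_True)
  then show False using card_le by simp
qed

section \<open>Levi-Civita connection and curvature\<close>

lemma scale_field_apply: "(f \<odot> X) p = f p *\<^sub>R X p"
  by (simp add: scale_field_def)

lemma vector_field_tangent: "vector_field A X \<Longrightarrow> X p \<in> tangent_space A p"
  by (simp add: vector_field_def)

lemma tangent_space_closed:
  assumes "v \<in> tangent_space A p"
  shows "w \<in> tangent_space A p \<Longrightarrow> v + w \<in> tangent_space A p" "c *\<^sub>R v \<in> tangent_space A p"
  using subspace_add[OF subspace_tangent_space assms] subspace_scale[OF subspace_tangent_space assms] by simp_all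

lemma add_field_apply: "(X + Y) p = X p + Y p" for X Y :: "'a vfield"
  by simp

locale riemannian_manifold =
  fixes A :: "('a::{t2_space,second_countable_topology}, 'e::euclidean_space) atlas"
    and g :: "'a bilin_field"
    and D :: "'a vfield \<Rightarrow> 'a vfield \<Rightarrow> 'a vfield"
  assumes atlas: "smooth_atlas A"
    and metric: "riemannian_metric A g"
    and connection: "levi_civita A g D"
begin

abbreviation VF :: "'a vfield \<Rightarrow> bool" where "VF \<equiv> vector_field A"
abbreviation SM :: "('a \<Rightarrow> real) \<Rightarrow> bool" where "SM \<equiv> smooth_fun A"
abbreviation G :: "'a vfield \<Rightarrow> 'a vfield \<Rightarrow> 'a \<Rightarrow> real" where "G \<equiv> bilin_app g"
abbreviation R :: "'a vfield \<Rightarrow> 'a vfield \<Rightarrow> 'a vfield \<Rightarrow> 'a vfield" where "R \<equiv> curvature D"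

lemma SM_deriv [simp]: "VF X \<Longrightarrow> SM f \<Longrightarrow> SM (deriv_along X f)"
  by (simp add: vector_field_def)

lemma SM_const [simp]: "SM (\<lambda>_. c)" by (rule smooth_fun_const)
lemma SM_add [simp]: "SM f \<Longrightarrow> SM h \<Longrightarrow> SM (\<lambda>p. f p + h p)" by (rule smooth_fun_add[OF atlas])
lemma SM_diff [simp]: "SM f \<Longrightarrow> SM h \<Longrightarrow> SM (\<lambda>p. f p - h p)" by (rule smooth_fun_diff[OF atlas])
lemma SM_mult [simp]: "SM f \<Longrightarrow> SM h \<Longrightarrow> SM (\<lambda>p. f p * h p)" by (rule smooth_fun_mult[OF atlas])

lemma deriv_add: "VF X \<Longrightarrow> SM f \<Longrightarrow> SM h \<Longrightarrow>
    deriv_along X (\<lambda>p. f p + h p) q = deriv_along X f q + deriv_along X h q"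
  unfolding deriv_along_def by (rule tangent_space_add[OF vector_field_tangent])

lemma deriv_diff: "VF X \<Longrightarrow> SM f \<Longrightarrow> SM h \<Longrightarrow>
    deriv_along X (\<lambda>p. f p - h p) q = deriv_along X f q - deriv_along X h q"
  unfolding deriv_along_def by (rule tangent_space_diff[OF atlas vector_field_tangent])

lemma deriv_mult: "VF X \<Longrightarrow> SM f \<Longrightarrow> SM h \<Longrightarrow>
    deriv_along X (\<lambda>p. f p * h p) q = f q * deriv_along X h q + h q * deriv_along X f q"
  unfolding deriv_along_def by (rule tangent_space_mult[OF vector_field_tangent])

lemma deriv_const: "VF X \<Longrightarrow> deriv_along X (\<lambda>_. c) q = 0"
  unfolding deriv_along_def by (rule tangent_space_const[OF vector_field_tangent])

lemma deriv_non_smooth: "VF X \<Longrightarrow> \<not> SM f \<Longrightarrow> deriv_along X f = (\<lambda>_. 0)"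
  unfolding deriv_along_def by (rule ext) (rule tangent_space_non_smooth[OF vector_field_tangent])

lemma deriv_scale_field: "deriv_along (f \<odot> X) h q = f q * deriv_along X h q"
  by (simp add: deriv_along_def scale_field_def)

lemma deriv_lie: "deriv_along (lie_bracket X Y) f q =
    deriv_along X (deriv_along Y f) q - deriv_along Y (deriv_along X f) q"
  by (simp add: deriv_along_def lie_bracket_def)

lemma VF_add [simp]: assumes "VF X" "VF Y" shows "VF (X + Y)"
  unfolding vector_field_def
proof (intro conjI allI impI)
  show "(X + Y) p \<in> tangent_space A p" for p
    unfolding add_field_apply by (intro tangent_space_closed vector_field_tangent assms)
  fix f assume f: "SM f"
  have "deriv_along (X + Y) f = (\<lambda>q. deriv_along X f q + deriv_along Y f q)"
    by (simp add: deriv_along_def fun_eq_iff)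
  then show "SM (deriv_along (X + Y) f)" using f assms by simp
qed

lemma VF_scale [simp]: assumes "SM f" "VF X" shows "VF (f \<odot> X)"
  unfolding vector_field_def
proof (intro conjI allI impI)
  show "(f \<odot> X) p \<in> tangent_space A p" for p
    unfolding scale_field_apply by (intro tangent_space_closed vector_field_tangent assms)
  fix h assume h: "SM h"
  have "deriv_along (f \<odot> X) h = (\<lambda>q. f q * deriv_along X h q)"
    by (rule ext) (rule deriv_scale_field)
  then show "SM (deriv_along (f \<odot> X) h)" using h assms by simp
qed

text \<open>Reduces every rule for negation to the corresponding rule for multiplication by a smooth
  function.\<close>

lemma uminus_field: "- X = (\<lambda>_. -1) \<odot> X" for X :: "'a vfield"
  by (simp add: scale_field_def fun_eq_iff)

lemma VF_uminus [simp]: "VF X \<Longrightarrow> VF (- X)"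
  unfolding uminus_field by (rule VF_scale) simp_all

lemma VF_diff [simp]: assumes "VF X" "VF Y" shows "VF (X - Y)"
  using VF_add[OF assms(1) VF_uminus[OF assms(2)]] by simp

lemma VF_zero [simp]: "VF 0"
  by (simp add: vector_field_def subspace_0[OF subspace_tangent_space] deriv_along_def)

lemma g_linear:
  assumes "u \<in> tangent_space A p" "v \<in> tangent_space A p" "w \<in> tangent_space A p"
  shows "g p u (v + w) = g p u v + g p u w" "g p u (c *\<^sub>R v) = c * g p u v" "g p u v = g p v u"
  using metric assms by (auto simp: riemannian_metric_def linear_on_space_def)

lemma G_sym: "VF X \<Longrightarrow> VF Y \<Longrightarrow> G X Y p = G Y X p"
  unfolding bilin_app_def by (rule g_linear(3)) (auto intro: vector_field_tangent)

lemma G_add_right: "VF X \<Longrightarrow> VF Y \<Longrightarrow> VF Z \<Longrightarrow> G X (Y + Z) p = G X Y p + G X Z p"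
  unfolding bilin_app_def add_field_apply by (rule g_linear(1)) (auto intro: vector_field_tangent)

lemma G_scale_right: "VF X \<Longrightarrow> VF Y \<Longrightarrow> G X (f \<odot> Y) p = f p * G X Y p"
  unfolding bilin_app_def scale_field_def by (rule g_linear(2)) (auto intro: vector_field_tangent)

lemma G_add_left: "VF X \<Longrightarrow> VF Y \<Longrightarrow> VF Z \<Longrightarrow> G (Y + Z) X p = G Y X p + G Z X p"
  using G_add_right G_sym VF_add by metis

lemma G_scale_left:
  assumes "VF X" "VF Y" shows "G (f \<odot> Y) X p = f p * G Y X p"
proof -
  have X: "X p \<in> tangent_space A p" and Y: "Y p \<in> tangent_space A p"
    using assms by (simp_all add: vector_field_tangent)
  have "g p (f p *\<^sub>R Y p) (X p) = g p (X p) (f p *\<^sub>R Y p)"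
    by (rule g_linear(3)[OF tangent_space_closed(2)[OF Y] X X])
  also have "\<dots> = f p * g p (Y p) (X p)"
    unfolding g_linear(2)[OF X Y Y] g_linear(3)[OF X Y Y] ..
  finally show ?thesis by (simp add: bilin_app_def scale_field_def)
qed

lemma G_uminus_left: "VF X \<Longrightarrow> VF Y \<Longrightarrow> G (- Y) X p = - G Y X p"
  unfolding uminus_field by (simp only: G_scale_left)

lemma G_uminus_right: "VF X \<Longrightarrow> VF Y \<Longrightarrow> G X (- Y) p = - G X Y p"
  unfolding uminus_field by (simp only: G_scale_right)

lemma G_diff_left: "VF X \<Longrightarrow> VF Y \<Longrightarrow> VF Z \<Longrightarrow> G (Y - Z) X p = G Y X p - G Z X p"
  using G_add_left[of X Y "- Z" p] G_uminus_left by simp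

lemma G_diff_right: "VF X \<Longrightarrow> VF Y \<Longrightarrow> VF Z \<Longrightarrow> G X (Y - Z) p = G X Y p - G X Z p"
  using G_add_right[of X Y "- Z" p] G_uminus_right by simp

lemma G_zero_left: "VF X \<Longrightarrow> G 0 X p = 0"
  using G_diff_left[of X X X p] by simp

lemma G_zero_right: "VF X \<Longrightarrow> G X 0 p = 0"
  using G_diff_right[of X X X p] by simp

lemmas G_simps = G_add_left G_add_right G_diff_left G_diff_right G_scale_left G_scale_right
  G_uminus_left G_uminus_right G_zero_left G_zero_right

lemma SM_G [simp]: "VF X \<Longrightarrow> VF Y \<Longrightarrow> SM (G X Y)"
  using metric by (simp add: riemannian_metric_def)

lemma G_nonneg: "VF X \<Longrightarrow> G X X p \<ge> 0"
proof (cases "X p = 0")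
  case True
  then have "G X X p = G X 0 p" by (simp add: bilin_app_def)
  then show "VF X \<Longrightarrow> ?thesis" by (simp add: G_zero_right)
next
  case False
  assume "VF X"
  then show ?thesis
    using False metric vector_field_tangent unfolding riemannian_metric_def bilin_app_def
    by (metis order_less_imp_le)
qed

lemma G_eq_0_iff: "VF X \<Longrightarrow> G X X p = 0 \<longleftrightarrow> X p = 0"
proof
  assume X: "VF X"
  show "X p = 0" if "G X X p = 0"
    using X that metric vector_field_tangent unfolding riemannian_metric_def bilin_app_def
    by (metis order_less_irrefl)
  show "G X X p = 0" if "X p = 0"
    using that G_zero_right[OF X, of p] by (simp add: bilin_app_def)
qed

text \<open>Nondegeneracy of the metric. Identities between fields become scalar identities against
  a test field \<open>Z\<close>, which \<open>G_simps\<close> normalises.\<close>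

lemma field_eqI_at:
  assumes "VF X" "VF Y" "\<And>Z. VF Z \<Longrightarrow> G X Z p = G Y Z p"
  shows "X p = Y p"
proof -
  have "G (X - Y) (X - Y) p = 0"
    using assms(3)[of "X - Y"] assms(1,2) by (simp add: G_diff_left)
  then have "(X - Y) p = 0" using G_eq_0_iff[OF VF_diff[OF assms(1,2)], of p] by (simp only:)
  then show ?thesis by simp
qed

lemma field_eqI:
  assumes "VF X" "VF Y" "\<And>Z p. VF Z \<Longrightarrow> G X Z p = G Y Z p"
  shows "X = Y"
  using field_eqI_at[OF assms(1,2)] assms(3) by (simp add: fun_eq_iff)

lemma VF_D [simp]: "VF X \<Longrightarrow> VF Y \<Longrightarrow> VF (D X Y)"
  using connection by (simp add: levi_civita_def)

lemma lie_eq: "VF X \<Longrightarrow> VF Y \<Longrightarrow> lie_bracket X Y = D X Y - D Y X"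
  using connection by (simp add: levi_civita_def)

lemma VF_lie [simp]: "VF X \<Longrightarrow> VF Y \<Longrightarrow> VF (lie_bracket X Y)"
  by (simp add: lie_eq)

lemma D_scale_left: "VF X \<Longrightarrow> VF Y \<Longrightarrow> SM f \<Longrightarrow> D (f \<odot> X) Y = f \<odot> D X Y"
  using connection by (simp add: levi_civita_def)

lemma D_scale_right: "VF X \<Longrightarrow> VF Y \<Longrightarrow> SM f \<Longrightarrow> D X (f \<odot> Y) = f \<odot> D X Y + deriv_along X f \<odot> Y"
  using connection by (simp add: levi_civita_def)

lemma D_add_left: "VF X \<Longrightarrow> VF Y \<Longrightarrow> VF Z \<Longrightarrow> D (X + Y) Z = D X Z + D Y Z"
  using connection by (simp add: levi_civita_def)

lemma D_add_right: "VF X \<Longrightarrow> VF Y \<Longrightarrow> VF Z \<Longrightarrow> D Z (X + Y) = D Z X + D Z Y"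
  using connection by (simp add: levi_civita_def)

lemma deriv_G: "VF X \<Longrightarrow> VF Y \<Longrightarrow> VF Z \<Longrightarrow>
    deriv_along Z (G X Y) p = G (D Z X) Y p + G X (D Z Y) p"
proof -
  assume "VF X" "VF Y" "VF Z"
  then have "deriv_along Z (G X Y) = G (D Z X) Y + G X (D Z Y)"
    using connection unfolding levi_civita_def by blast
  then show ?thesis by simp
qed

lemma D_uminus_left: "VF X \<Longrightarrow> VF Y \<Longrightarrow> D (- X) Y = - D X Y"
  unfolding uminus_field by (simp add: D_scale_left)

lemma D_zero_right: "VF X \<Longrightarrow> D X 0 = 0"
  using D_add_right[of 0 0 X] by simp

lemma D_uminus_right: "VF X \<Longrightarrow> VF Y \<Longrightarrow> D X (- Y) = - D X Y"
  using D_add_right[of Y "- Y" X] by (simp add: D_zero_right eq_neg_iff_add_eq_0 add.commute)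

lemma D_diff_left: "VF X \<Longrightarrow> VF Y \<Longrightarrow> VF Z \<Longrightarrow> D (X - Y) Z = D X Z - D Y Z"
  using D_add_left[of X "- Y" Z] D_uminus_left by simp

lemma D_diff_right: "VF X \<Longrightarrow> VF Y \<Longrightarrow> VF Z \<Longrightarrow> D Z (X - Y) = D Z X - D Z Y"
  using D_add_right[of X "- Y" Z] D_uminus_right by simp

lemma lie_skew: "VF X \<Longrightarrow> VF Y \<Longrightarrow> lie_bracket X Y = - lie_bracket Y X"
  by (simp add: lie_eq)

text \<open>Both sides expand into third derivatives of \<open>f\<close>. Non-smooth
  \<open>f\<close> is a separate case because the identity is one of total functionals; there all
  derivatives are 0 by convention.\<close>

lemma lie_jacobi:
  assumes "VF X" "VF Y" "VF Z"
  shows "lie_bracket X (lie_bracket Y Z) = lie_bracket (lie_bracket X Y) Z + lie_bracket Y (lie_bracket X Z)"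
proof (intro ext)
  fix p f
  let ?d = deriv_along
  have exp: "?d X (?d (lie_bracket Y Z) f) p = ?d X (?d Y (?d Z f)) p - ?d X (?d Z (?d Y f)) p"
    if "VF X" "VF Y" "VF Z" for X Y Z
  proof (cases "SM f")
    case True
    then show ?thesis
      using that deriv_diff[of X "?d Y (?d Z f)" "?d Z (?d Y f)" p]
      by (simp add: deriv_lie[abs_def] eta_contract_eq deriv_lie fun_eq_iff)
  next
    case False
    have "?d W (\<lambda>_. 0) = (\<lambda>_. 0)" if "VF W" for W
      by (rule ext) (rule deriv_const[OF that])
    then show ?thesis using that deriv_non_smooth[OF _ False] by simp
  qed
  have "?d (lie_bracket X (lie_bracket Y Z)) f p =
      ?d (lie_bracket (lie_bracket X Y) Z) f p + ?d (lie_bracket Y (lie_bracket X Z)) f p"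
    unfolding deriv_lie exp[OF assms] exp[OF assms(2,1,3)] exp[OF assms(3,1,2)] by simp
  then show "lie_bracket X (lie_bracket Y Z) p f
      = (lie_bracket (lie_bracket X Y) Z + lie_bracket Y (lie_bracket X Z)) p f"
    by (simp add: deriv_along_def)
qed

section \<open>The curvature tensor: linearity over smooth functions and skew symmetries\<close>

lemma VF_R [simp]: "VF X \<Longrightarrow> VF Y \<Longrightarrow> VF Z \<Longrightarrow> VF (R X Y Z)"
  by (simp add: curvature_def)

lemma R_skew: "VF X \<Longrightarrow> VF Y \<Longrightarrow> VF Z \<Longrightarrow> R X Y Z = - R Y X Z"
  by (simp add: curvature_def lie_eq D_diff_left)

lemma R_add_left: "VF X \<Longrightarrow> VF X' \<Longrightarrow> VF Y \<Longrightarrow> VF Z \<Longrightarrow> R (X + X') Y Z = R X Y Z + R X' Y Z"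
  by (simp add: curvature_def lie_eq D_diff_left D_add_left D_add_right)

lemma R_add_right: "VF X \<Longrightarrow> VF Y \<Longrightarrow> VF Z \<Longrightarrow> VF Z' \<Longrightarrow> R X Y (Z + Z') = R X Y Z + R X Y Z'"
  by (simp add: curvature_def D_add_right)

text \<open>The term \<open>deriv_along Y f\<close> produced by \<open>D Y\<close> cancels against
  the one produced by the bracket of \<open>f \<odot> X\<close> and \<open>Y\<close>.\<close>

lemma R_scale_left:
  assumes "VF X" "VF Y" "VF Z" "SM f"
  shows "R (f \<odot> X) Y Z = f \<odot> R X Y Z"
  by (rule field_eqI)
     (use assms in \<open>simp_all add: curvature_def lie_eq D_diff_left D_add_left D_scale_left D_scale_right G_simps algebra_simps\<close>)

text \<open>The second derivatives of \<open>f\<close> combine to the commutator of \<open>X\<close>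
  and \<open>Y\<close> minus their bracket applied to \<open>f\<close>, which is zero; the mixed
  first-order terms cancel in pairs.\<close>

lemma R_scale_right:
  assumes "VF X" "VF Y" "VF Z" "SM f"
  shows "R X Y (f \<odot> Z) = f \<odot> R X Y Z"
  by (rule field_eqI)
     (use assms in \<open>simp_all add: curvature_def D_add_right D_scale_right G_simps deriv_lie algebra_simps\<close>)

text \<open>The bracket of \<open>X\<close> and \<open>Y\<close>, applied to \<open>G Z W\<close>,
  is computed in two ways: as a commutator and by metric compatibility. The mixed products of first
  derivatives are symmetric in \<open>X\<close> and \<open>Y\<close> and drop out.\<close>

lemma R_skew_G:
  assumes "VF X" "VF Y" "VF Z" "VF W"
  shows "G (R X Y Z) W p = - G (R X Y W) Z p"
proof -
  have 1: "deriv_along X (deriv_along Y (G Z W)) p =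
      G (D X (D Y Z)) W p + G (D Y Z) (D X W) p + (G (D X Z) (D Y W) p + G Z (D X (D Y W)) p)"
    if "VF X" "VF Y" for X Y
  proof -
    have "deriv_along Y (G Z W) = (\<lambda>q. G (D Y Z) W q + G Z (D Y W) q)"
      using deriv_G that assms by (simp add: fun_eq_iff)
    then show ?thesis using that assms by (simp add: deriv_add deriv_G)
  qed
  have "deriv_along X (deriv_along Y (G Z W)) p - deriv_along Y (deriv_along X (G Z W)) p =
      G (D (lie_bracket X Y) Z) W p + G Z (D (lie_bracket X Y) W) p"
    using deriv_lie[of X Y "G Z W" p] deriv_G[of Z W "lie_bracket X Y" p] assms by simp
  then show ?thesis
    using 1[of X Y] 1[of Y X] assms G_sym[of Z _ p]
    by (simp add: curvature_def G_simps)
qed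

end

section \<open>Contact metric manifolds\<close>

locale contact_metric_manifold = riemannian_manifold A g D
  for A :: "('a::{t2_space,second_countable_topology}, 'e::euclidean_space) atlas"
    and g :: "'a bilin_field" and D :: "'a vfield \<Rightarrow> 'a vfield \<Rightarrow> 'a vfield" +
  fixes \<phi> :: "'a endo_field" and \<xi> :: "'a vfield" and \<eta> :: "'a one_form"
  assumes contact: "contact_metric A \<phi> \<xi> \<eta> g"
begin

abbreviation J :: "'a vfield \<Rightarrow> 'a vfield" where "J \<equiv> endo_app \<phi>"

text \<open>\<open>S\<close> is \<open>- \<phi> h\<close>, the symmetric part of \<open>X \<mapsto> D X \<xi>\<close>, and \<open>N\<close> is its covariant
  derivative along \<open>\<xi>\<close>.\<close>

definition S :: "'a vfield \<Rightarrow> 'a vfield" where "S X = D X \<xi> + J X"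

definition N :: "'a vfield \<Rightarrow> 'a vfield" where "N X = D \<xi> (S X) - S (D \<xi> X)"

section \<open>Algebra of the structure tensors and the covariant derivative of the Reeb
  field\<close>

lemma VF_xi [simp]: "VF \<xi>" and VF_J [simp]: "VF X \<Longrightarrow> VF (J X)"
  using contact by (simp_all add: contact_metric_def smooth_endo_field_def)

lemma eta_eq: "VF X \<Longrightarrow> form_app \<eta> X = G X \<xi>"
  using contact by (simp add: contact_metric_def)

lemma G_xi_xi: "G \<xi> \<xi> = (\<lambda>_. 1)"
  using contact by (simp add: contact_metric_def one_fun_def)

lemma J_linear:
  assumes "VF X"
  shows J_add: "VF Y \<Longrightarrow> J (X + Y) = J X + J Y" and J_scale: "J (f \<odot> X) = f \<odot> J X"
  using contact assms vector_field_tangent[of A]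
  unfolding contact_metric_def smooth_endo_field_def linear_on_space_def endo_app_def scale_field_def
  by (simp_all add: fun_eq_iff)

lemma J_uminus: "VF X \<Longrightarrow> J (- X) = - J X"
  unfolding uminus_field by (rule J_scale)

lemma J_diff: "VF X \<Longrightarrow> VF Y \<Longrightarrow> J (X - Y) = J X - J Y"
  using J_add[of X "- Y"] J_uminus by simp

lemma ext_deriv_eq: "VF X \<Longrightarrow> VF Y \<Longrightarrow> ext_deriv \<eta> X Y = G X (J Y)"
  using contact by (simp add: contact_metric_def)

lemma G_J_eq:
  assumes "VF X" "VF Y"
  shows "2 * G X (J Y) p = deriv_along X (G Y \<xi>) p - deriv_along Y (G X \<xi>) p - G (lie_bracket X Y) \<xi> p"
  using fun_cong[OF ext_deriv_eq[OF assms], of p] assms by (simp add: ext_deriv_def eta_eq)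

text \<open>Inherited from d \<eta>: the right-hand side of \<open>G_J_eq\<close> changes sign when
  \<open>X\<close> and \<open>Y\<close> are exchanged.\<close>

lemma G_J_skew:
  assumes "VF X" "VF Y"
  shows "G (J X) Y p = - G X (J Y) p"
  using G_J_eq[OF assms, of p] G_J_eq[OF assms(2,1), of p] assms lie_skew[of X Y] G_sym[of "J X" Y p]
  by (simp add: G_uminus_left)

lemma J_xi: "J \<xi> = 0"
proof (rule field_eqI)
  fix Z p assume Z: "VF Z"
  have "ext_deriv \<eta> \<xi> Z = 0" using contact Z unfolding contact_metric_def by blast
  then have "G \<xi> (J Z) p = 0" using Z by (simp add: ext_deriv_eq)
  then show "G (J \<xi>) Z p = G 0 Z p" using Z by (simp add: G_J_skew G_zero_left)
qed simp_all

lemma G_J_xi: "VF X \<Longrightarrow> G (J X) \<xi> p = 0" "VF X \<Longrightarrow> G \<xi> (J X) p = 0"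
  using G_J_skew[of X \<xi>] G_J_skew[of \<xi> X] by (simp_all add: J_xi G_simps)

lemma J_J: "VF X \<Longrightarrow> J (J X) = - X + G X \<xi> \<odot> \<xi>"
  using contact eta_eq[of X] by (simp add: contact_metric_def)

lemma G_J_J:
  assumes "VF X" "VF Y"
  shows "G (J X) (J Y) p = G X Y p - G X \<xi> p * G Y \<xi> p"
  using assms G_sym[of X \<xi>] G_sym[of Y \<xi>] by (simp add: G_J_skew J_J G_simps)

lemma D_xi_orthogonal: "VF X \<Longrightarrow> G (D X \<xi>) \<xi> p = 0"
  using deriv_G[of \<xi> \<xi> X p] G_sym[of \<xi> "D X \<xi>" p] by (simp add: G_xi_xi deriv_const)

text \<open>Expanding d \<eta> with a torsion-free metric connection leaves only the skew part of
  the covariant derivative of \<xi>. Hence adding \<open>J\<close> to it, as in \<open>S\<close>,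
  leaves a symmetric operator.\<close>

lemma D_xi_skew_part:
  assumes "VF X" "VF Y"
  shows "G (D X \<xi>) Y p - G (D Y \<xi>) X p = 2 * G X (J Y) p"
  using G_J_eq[OF assms] assms G_sym[of Y "D X \<xi>" p] G_sym[of X "D Y \<xi>" p]
  by (simp add: deriv_G lie_eq G_simps)

text \<open>The Reeb field is geodesic: in \<open>D_xi_skew_part\<close> with
  \<open>Y = \<xi>\<close> all other terms vanish, since \<xi> has unit length and
  \<open>J \<xi> = 0\<close>.\<close>

lemma D_xi_xi: "D \<xi> \<xi> = 0"
  by (rule field_eqI) (use D_xi_skew_part[of _ \<xi>] in \<open>simp_all add: D_xi_orthogonal J_xi G_simps\<close>)

lemma VF_S [simp]: "VF X \<Longrightarrow> VF (S X)"
  by (simp add: S_def)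

lemma D_xi_eq: "D X \<xi> = S X - J X"
  by (simp add: S_def)

lemma S_add: "VF X \<Longrightarrow> VF Y \<Longrightarrow> S (X + Y) = S X + S Y"
  by (simp add: S_def D_add_left J_add)

lemma S_diff: "VF X \<Longrightarrow> VF Y \<Longrightarrow> S (X - Y) = S X - S Y"
  by (simp add: S_def D_diff_left J_diff)

lemma S_scale: "VF X \<Longrightarrow> SM f \<Longrightarrow> S (f \<odot> X) = f \<odot> S X"
  by (rule field_eqI) (simp_all add: S_def D_scale_left J_scale G_simps algebra_simps)

lemma S_sym: "VF X \<Longrightarrow> VF Y \<Longrightarrow> G (S X) Y p = G X (S Y) p"
  using D_xi_skew_part[of X Y p] G_J_skew[of X Y p] G_sym[of X "D Y \<xi>" p]
  by (simp add: S_def G_simps)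

lemma S_xi: "S \<xi> = 0"
  by (simp add: S_def D_xi_xi J_xi)

lemma G_S_xi: "VF X \<Longrightarrow> G (S X) \<xi> p = 0" "VF X \<Longrightarrow> G \<xi> (S X) p = 0"
  using D_xi_orthogonal[of X p] G_J_xi[of X p] G_sym[of \<xi> "S X" p] by (simp_all add: S_def G_simps)

section \<open>Anticommutation of \<open>S\<close> with \<open>J\<close>\<close>

text \<open>This says that the Lie derivative of d \<eta> along \<xi> vanishes. It follows from the
  same statement for \<eta>, which is \<open>eta_lie\<close>, and the Jacobi identity.\<close>

lemma lie_xi_G_J:
  assumes "VF X" "VF Y"
  shows "deriv_along \<xi> (G X (J Y)) p = G (lie_bracket \<xi> X) (J Y) p + G X (J (lie_bracket \<xi> Y)) p"
proof -
  let ?d = deriv_along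
  have eta_lie: "G (lie_bracket \<xi> Z) \<xi> q = ?d \<xi> (G Z \<xi>) q" if "VF Z" for Z q
    using that deriv_G[of Z \<xi> \<xi> q] D_xi_orthogonal[of Z q]
    by (simp add: lie_eq G_simps D_xi_xi)
  then have eta_lie': "G (lie_bracket \<xi> Z) \<xi> = ?d \<xi> (G Z \<xi>)" if "VF Z" for Z
    using that by (simp add: fun_eq_iff)
  have "(\<lambda>q. 2 * G X (J Y) q) = (\<lambda>q. ?d X (G Y \<xi>) q - ?d Y (G X \<xi>) q - G (lie_bracket X Y) \<xi> q)"
    using G_J_eq[OF assms] by simp
  then have "?d \<xi> (\<lambda>q. 2 * G X (J Y) q) p =
      ?d \<xi> (?d X (G Y \<xi>)) p - ?d \<xi> (?d Y (G X \<xi>)) p - ?d \<xi> (G (lie_bracket X Y) \<xi>) p"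
    using assms by (simp add: deriv_diff)
  moreover have "?d \<xi> (\<lambda>q. 2 * G X (J Y) q) p = 2 * ?d \<xi> (G X (J Y)) p"
    using assms by (simp add: deriv_mult deriv_const)
  moreover have "?d \<xi> (G (lie_bracket X Y) \<xi>) p =
      G (lie_bracket (lie_bracket \<xi> X) Y) \<xi> p + G (lie_bracket X (lie_bracket \<xi> Y)) \<xi> p"
    using eta_lie[of "lie_bracket X Y" p] lie_jacobi[of \<xi> X Y] assms by (simp add: G_simps)
  moreover have "2 * G (lie_bracket \<xi> X) (J Y) p =
      ?d \<xi> (?d X (G Y \<xi>)) p - ?d X (?d \<xi> (G Y \<xi>)) p - ?d Y (?d \<xi> (G X \<xi>)) p
      - G (lie_bracket (lie_bracket \<xi> X) Y) \<xi> p"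
    using G_J_eq[of "lie_bracket \<xi> X" Y p] assms by (simp add: eta_lie' deriv_lie)
  moreover have "2 * G X (J (lie_bracket \<xi> Y)) p =
      ?d X (?d \<xi> (G Y \<xi>)) p - (?d \<xi> (?d Y (G X \<xi>)) p - ?d Y (?d \<xi> (G X \<xi>)) p)
      - G (lie_bracket X (lie_bracket \<xi> Y)) \<xi> p"
    using G_J_eq[of X "lie_bracket \<xi> Y" p] assms by (simp add: eta_lie' deriv_lie)
  ultimately show ?thesis by simp
qed

text \<open>Closedness of \<open>d \<eta>\<close> gives \<open>D\<^sub>\<xi> \<phi> = - (S \<phi> + \<phi> S)\<close>. Composed with \<open>\<phi>\<close>, the left
  hand side is skew and the right hand side is symmetric, so both vanish.\<close>

lemma D_xi_phi_eq:
  assumes "VF X" "VF Y"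
  shows "G X (D \<xi> (J Y) - J (D \<xi> Y)) p = - G X (S (J Y) + J (S Y)) p"
  using lie_xi_G_J[OF assms, of p] deriv_G[of X "J Y" \<xi> p] assms
    G_J_skew[of X "J Y" p] S_sym[of X "J Y" p] G_sym[of "J X" "J Y" p]
  by (simp add: lie_eq D_xi_eq J_diff G_simps)

text \<open>Comes from differentiating the identity \<open>G_J_J\<close> along \<xi>, using that
  \<xi> is geodesic.\<close>

lemma D_xi_phi_phi_skew:
  assumes "VF X" "VF Y"
  shows "G X (D \<xi> (J (J Y)) - J (D \<xi> (J Y))) p = - G Y (D \<xi> (J (J X)) - J (D \<xi> (J X))) p"
proof -
  have "(\<lambda>q. G (J X) (J Y) q) = (\<lambda>q. G X Y q - G X \<xi> q * G Y \<xi> q)"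
    using G_J_J[OF assms] by simp
  then have "deriv_along \<xi> (G (J X) (J Y)) p = deriv_along \<xi> (\<lambda>q. G X Y q - G X \<xi> q * G Y \<xi> q) p"
    by simp
  then have "G (D \<xi> (J X)) (J Y) p + G (J X) (D \<xi> (J Y)) p =
      G (D \<xi> X) Y p + G X (D \<xi> Y) p
      - (G X \<xi> p * deriv_along \<xi> (G Y \<xi>) p + G Y \<xi> p * deriv_along \<xi> (G X \<xi>) p)"
    using assms by (simp add: deriv_diff deriv_mult deriv_G)
  moreover have e: "G U (D \<xi> (J (J W)) - J (D \<xi> (J W))) p =
      - G U (D \<xi> W) p + deriv_along \<xi> (G W \<xi>) p * G U \<xi> p + G (J U) (D \<xi> (J W)) p"
    if "VF U" "VF W" for U W
    using that G_J_skew[of U "D \<xi> (J W)" p]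
    by (simp add: J_J D_diff_right D_scale_right D_xi_xi G_simps)
  ultimately show ?thesis
    using assms G_sym[of "D \<xi> X" Y p] G_sym[of "D \<xi> (J X)" "J Y" p]
    unfolding e[OF assms] e[OF assms(2,1)] by (simp add: algebra_simps)
qed

text \<open>The form \<open>G U (S W) p + G (J U) (S (J W)) p\<close> is symmetric because
  \<open>S\<close> is, and skew by \<open>D_xi_phi_phi_skew\<close>; so it is zero.\<close>

lemma S_eq_J_S_J: "VF X \<Longrightarrow> S X = J (S (J X))"
proof (rule field_eqI)
  fix Z p assume X: "VF X" and Z: "VF Z"
  have e: "G U (D \<xi> (J (J W)) - J (D \<xi> (J W))) p = G U (S W) p + G (J U) (S (J W)) p" if "VF U" "VF W" for U W
    using D_xi_phi_eq[of U "J W" p] that G_J_skew[of U "S (J W)" p]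
    by (simp add: J_J S_diff S_scale S_xi G_simps)
  have "G Z (S X) p = - G (J Z) (S (J X)) p"
    using e[of Z X] e[of X Z] D_xi_phi_phi_skew[of Z X p] X Z S_sym[of X Z p] S_sym[of "J X" "J Z" p]
      G_sym[of Z "S X" p] G_sym[of "J Z" "S (J X)" p] by simp
  then show "G (S X) Z p = G (J (S (J X))) Z p"
    using X Z G_J_skew[of "S (J X)" Z p] G_sym[of Z "S X" p] G_sym[of "J Z" "S (J X)" p] by simp
qed simp_all

lemma S_J: "VF X \<Longrightarrow> S (J X) = - J (S X)"
proof -
  assume X: "VF X"
  have "J (S X) = J (J (S (J X)))" using S_eq_J_S_J[OF X] by simp
  also have "\<dots> = - S (J X)"
    by (rule field_eqI) (use X in \<open>simp_all add: J_J G_S_xi G_simps\<close>)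
  finally show ?thesis by simp
qed

lemma D_xi_J: "VF X \<Longrightarrow> D \<xi> (J X) = J (D \<xi> X)"
proof (rule field_eqI)
  fix Z p assume X: "VF X" and Z: "VF Z"
  then show "G (D \<xi> (J X)) Z p = G (J (D \<xi> X)) Z p"
    using D_xi_phi_eq[of Z X p] G_sym[of Z _ p] by (simp add: S_J G_simps)
qed simp_all

text \<open>Replacing brackets by covariant derivatives, the terms with \<open>D \<xi>\<close>
  cancel since it commutes with \<open>J\<close>, and anticommutation merges the rest into twice
  \<open>J (S X)\<close>.\<close>

lemma h_tensor_eq: "VF X \<Longrightarrow> h_tensor \<phi> \<xi> X = J (S X)"
proof -
  assume X: "VF X"
  have "h_tensor \<phi> \<xi> X = (\<lambda>_. 1/2) \<odot> (lie_bracket \<xi> (J X) - J (lie_bracket \<xi> X))"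
    by (simp add: h_tensor_def lie_deriv_endo_def scale_field_def scaleR_fun_def)
  also have "\<dots> = J (S X)"
  proof (rule field_eqI)
    fix Z p assume Z: "VF Z"
    have "G (S (J X)) Z p = - G (J (S X)) Z p" using X Z by (simp add: S_J G_simps)
    then show "G ((\<lambda>_. 1/2) \<odot> (lie_bracket \<xi> (J X) - J (lie_bracket \<xi> X))) Z p = G (J (S X)) Z p"
      using X Z by (simp add: lie_eq D_xi_eq D_xi_J J_diff G_simps)
  qed (use X in simp_all)
  finally show ?thesis .
qed

text \<open>\<open>S X\<close> is orthogonal to \<xi>, and \<open>J\<close> is isometric on such
  fields; so \<open>h\<close> and \<open>S\<close> vanish at the same points.\<close>

lemma J_S_eq_0_iff: "VF X \<Longrightarrow> J (S X) p = 0 \<longleftrightarrow> S X p = 0"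
  using G_eq_0_iff[of "J (S X)" p] G_eq_0_iff[of "S X" p] G_J_J[of "S X" "S X" p] by (simp add: G_S_xi)

lemma h_nonzero_set_eq: "h_nonzero_set A \<phi> \<xi> = {p. \<exists>X. VF X \<and> S X p \<noteq> 0}"
  unfolding h_nonzero_set_def
  by (intro Collect_cong ex_cong1 conj_cong refl) (simp add: h_tensor_eq J_S_eq_0_iff)

text \<open>A union, over all fields \<open>X\<close>, of the sets where the continuous function
  \<open>G (S X) (S X)\<close> is nonzero.\<close>

lemma open_h_nonzero_set: "open (h_nonzero_set A \<phi> \<xi>)"
proof -
  have "h_nonzero_set A \<phi> \<xi> = (\<Union>X\<in>Collect VF. {p. G (S X) (S X) p \<noteq> 0})"
    unfolding h_nonzero_set_eq using G_eq_0_iff[OF VF_S] by auto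
  moreover have "open {p. G (S X) (S X) p \<noteq> 0}" if "VF X" for X
    using smooth_fun_continuous[OF atlas SM_G[OF VF_S VF_S]] that
    by (intro open_Collect_neq) auto
  ultimately show ?thesis by auto
qed

lemma VF_N [simp]: "VF X \<Longrightarrow> VF (N X)"
  by (simp add: N_def)

lemma N_J: "VF X \<Longrightarrow> N (J X) = - J (N X)"
  by (simp add: N_def S_J D_xi_J J_diff D_uminus_right)

text \<open>The term with \<open>D \<xi> \<xi>\<close> vanishes. Inserting
  \<open>D X \<xi> = S X - J X\<close> twice, the cross terms \<open>S (J X)\<close> and
  \<open>J (S X)\<close> cancel by anticommutation.\<close>

lemma G_R_xi_xi:
  assumes "VF X" "VF Y"
  shows "G (R X \<xi> \<xi>) Y p = - G (N X) Y p - G (S X) (S Y) p - G (J (J X)) Y p"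
proof -
  have "R X \<xi> \<xi> = - D \<xi> (S X - J X) - (S (lie_bracket X \<xi>) - J (lie_bracket X \<xi>))"
    using assms by (simp add: curvature_def D_xi_xi D_zero_right flip: D_xi_eq)
  then show ?thesis
    using assms S_sym[of "S X" Y p]
    by (simp add: lie_eq D_xi_eq S_diff J_diff D_diff_right D_xi_J N_def S_J G_simps)
qed

lemma lie_deriv_G:
  assumes "VF V" "VF X" "VF Y"
  shows "lie_deriv_bilin V g X Y p = G (D X V) Y p + G X (D Y V) p"
  using assms by (simp add: lie_deriv_bilin_def lie_eq deriv_G G_simps)

text \<open>Symmetrisation removes the skew part \<open>J\<close> of the covariant derivative of
  \<xi>, leaving \<open>S\<close> and the derivatives of \<open>f\<close>.\<close>

lemma lie_deriv_G_collinear: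
  assumes "SM f" "VF X" "VF Y"
  shows "lie_deriv_bilin (f \<odot> \<xi>) g X Y p =
    2 * f p * G (S X) Y p + deriv_along X f p * G \<xi> Y p + deriv_along Y f p * G X \<xi> p"
  using assms S_sym[of X Y p] G_J_skew[of X Y p]
  by (simp add: lie_deriv_G D_scale_right D_xi_eq G_simps algebra_simps)

end

section \<open>Dimension 3\<close>

locale contact_metric_3_manifold = contact_metric_manifold A g D \<phi> \<xi> \<eta>
  for A :: "('a::{t2_space,second_countable_topology}, real^3) atlas"
    and g :: "'a bilin_field" and D :: "'a vfield \<Rightarrow> 'a vfield \<Rightarrow> 'a vfield"
    and \<phi> :: "'a endo_field" and \<xi> :: "'a vfield" and \<eta> :: "'a one_form"
begin

definition horizontal :: "'a vfield \<Rightarrow> bool" where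
  "horizontal e \<longleftrightarrow> VF e \<and> G e \<xi> = (\<lambda>_. 0)"

abbreviation Ric :: "'a vfield \<Rightarrow> 'a vfield \<Rightarrow> 'a \<Rightarrow> real" where "Ric \<equiv> ricci A g D"

lemma horizontalD: "horizontal e \<Longrightarrow> VF e" "horizontal e \<Longrightarrow> G e \<xi> p = 0" "horizontal e \<Longrightarrow> G \<xi> e p = 0"
  using G_sym[of \<xi> e p] by (simp_all add: horizontal_def)

lemma horizontal_J: "horizontal e \<Longrightarrow> horizontal (J e)"
  by (simp add: horizontal_def fun_eq_iff G_J_xi)

lemma horizontal_add: "horizontal e \<Longrightarrow> horizontal e' \<Longrightarrow> horizontal (e + e')"
  by (simp add: horizontal_def fun_eq_iff G_simps)

lemma horizontal_scale: "horizontal e \<Longrightarrow> SM f \<Longrightarrow> horizontal (f \<odot> e)"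
  by (simp add: horizontal_def fun_eq_iff G_simps)

lemma horizontal_part: "VF X \<Longrightarrow> horizontal (X - G X \<xi> \<odot> \<xi>)"
  by (simp add: horizontal_def fun_eq_iff G_simps G_xi_xi)

lemma horizontal_D_xi: "horizontal e \<Longrightarrow> horizontal (D \<xi> e)"
  using deriv_G[of e \<xi> \<xi>] by (auto simp: horizontal_def D_xi_xi G_simps deriv_const intro!: ext)

lemma G_e_J_e: "VF e \<Longrightarrow> G e (J e) p = 0" "VF e \<Longrightarrow> G (J e) e p = 0"
  using G_J_skew[of e e p] G_sym[of e "J e" p] by simp_all

lemma G_J_horizontal: "horizontal e \<Longrightarrow> VF X \<Longrightarrow> G (J e) (J X) p = G e X p"
  by (simp add: G_J_J horizontalD)

lemma less_3_iff: "i < DIM(real^3) \<longleftrightarrow> i = 0 \<or> i = 1 \<or> i = (2::nat)"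
  by auto

lemma sum_less_3: "(\<Sum>i<DIM(real^3). f i) = f 0 + f 1 + f (2::nat)" for f :: "nat \<Rightarrow> 'z::comm_monoid_add"
  by (simp add: numeral_3_eq_3 numeral_2_eq_2)

section \<open>Adapted orthonormal bases and expansions\<close>

lemma orthonormal_adapted:
  assumes "horizontal e" "G e e p = 1"
  shows "orthonormal_at A g p (\<lambda>i. if i = 0 then e else if i = 1 then J e else \<xi>)"
  unfolding orthonormal_at_def
proof (intro conjI allI impI)
  show "VF (if i = 0 then e else if i = 1 then J e else \<xi>)" for i :: nat
    using assms(1) by (simp add: horizontalD)
  have "G e e p = 1" "G (J e) (J e) p = 1" "G \<xi> \<xi> p = 1" "G e (J e) p = 0" "G (J e) e p = 0"
    "G e \<xi> p = 0" "G \<xi> e p = 0" "G (J e) \<xi> p = 0" "G \<xi> (J e) p = 0"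
    using assms G_J_horizontal[of e e p] G_e_J_e[of e p] G_J_xi[of e p]
    by (simp_all add: horizontalD G_xi_xi)
  then show "g p ((if i = 0 then e else if i = 1 then J e else \<xi>) p)
      ((if j = 0 then e else if j = 1 then J e else \<xi>) p) = (if i = j then 1 else 0)"
    if "i < DIM(real^3)" "j < DIM(real^3)" for i j :: nat
    using that unfolding less_3_iff bilin_app_def by auto
qed

lemma orthonormal_VF: "orthonormal_at A g p E \<Longrightarrow> VF (E 0) \<and> VF (E 1) \<and> VF (E 2)"
  unfolding orthonormal_at_def less_3_iff by blast

lemma orthonormal_parseval:
  assumes E: "orthonormal_at A g p E" and "VF Y" "VF Z"
  shows "G Y Z p = (\<Sum>i<DIM(real^3). G Y (E i) p * G (E i) Z p)"
proof -
  \<comment> \<open>The coefficients are frozen at \<open>p\<close> as constant functions, so that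
    \<open>?W\<close> is a smooth field whose value at \<open>p\<close> is
    \<open>Y p\<close>.\<close>
  let ?c = "\<lambda>i. (\<lambda>_::'a. G Y (E i) p)"
  let ?W = "?c 0 \<odot> E 0 + ?c 1 \<odot> E 1 + ?c 2 \<odot> E 2"
  have V: "VF (E 0)" "VF (E 1)" "VF (E 2)" using orthonormal_VF[OF E] by auto
  have "Y p = ?W p"
    using orthonormal_tangent_expansion[OF atlas metric E vector_field_tangent[OF \<open>VF Y\<close>]]
    unfolding sum_less_3 add_field_apply scale_field_apply bilin_app_def .
  then have "G Y Z p = G ?W Z p" by (simp only: bilin_app_def)
  also have "\<dots> = (\<Sum>i<DIM(real^3). G Y (E i) p * G (E i) Z p)"
    using V \<open>VF Z\<close> unfolding sum_less_3 by (simp add: G_simps)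
  finally show ?thesis .
qed

text \<open>No hypothesis \<open>e p \<noteq> 0\<close>: this lets the expansion hold as an identity of fields, so that it can
  be fed to operators that are only linear over smooth functions.\<close>

lemma adapted_expansion:
  assumes e: "horizontal e" and "VF Y" "VF Z"
  shows "G e e p * G Y Z p = G Y e p * G e Z p + G Y (J e) p * G (J e) Z p
      + G e e p * G Y \<xi> p * G \<xi> Z p"
proof (cases "G e e p = 0")
  case True
  note [simp] = horizontalD(1)[OF e]
  have "e p = 0" using True G_eq_0_iff[of e p] by simp
  then have 0: "G e X p = 0" if "VF X" for X
    using G_zero_left[OF that, of p] by (simp add: bilin_app_def)
  then have "G (J e) X p = 0" if "VF X" for X using that by (simp add: G_J_skew)
  with 0 True show ?thesis using assms by simp
next
  case False
  note [simp] = horizontalD(1)[OF e]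
  \<comment> \<open>A constant factor makes \<open>e\<close> a unit vector at \<open>p\<close> and
    keeps it horizontal everywhere. The first two terms of the expansion are quadratic in
    \<open>e\<close> and pick up \<open>c * c\<close>.\<close>
  define c where "c = 1 / sqrt (G e e p)"
  have c: "c * c * G e e p = 1"
    using False G_nonneg[of e p] by (simp add: c_def field_simps)
  define e' where "e' = (\<lambda>_. c) \<odot> e"
  have e': "horizontal e'" "G e' e' p = 1"
    using c e by (simp_all add: e'_def horizontal_scale G_simps mult.assoc)
  have "G Y Z p = G Y e' p * G e' Z p + G Y (J e') p * G (J e') Z p + G Y \<xi> p * G \<xi> Z p"
    using orthonormal_parseval[OF orthonormal_adapted[OF e'] assms(2,3)] unfolding sum_less_3 by simp
  also have "\<dots> = c * c * (G Y e p * G e Z p + G Y (J e) p * G (J e) Z p) + G Y \<xi> p * G \<xi> Z p"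
    using assms by (simp add: e'_def J_scale G_simps algebra_simps)
  finally have "G e e p * G Y Z p = (c * c * G e e p) * (G Y e p * G e Z p + G Y (J e) p * G (J e) Z p)
      + G e e p * G Y \<xi> p * G \<xi> Z p"
    by (simp add: algebra_simps)
  then show ?thesis unfolding c by simp
qed

lemma adapted_expansion_field:
  assumes e: "horizontal e" and Y: "VF Y"
  shows "G e e \<odot> Y = G Y e \<odot> e + G Y (J e) \<odot> J e + (\<lambda>p. G e e p * G Y \<xi> p) \<odot> \<xi>"
proof (rule field_eqI)
  note [simp] = horizontalD(1)[OF e] Y
  fix Z p assume Z: "VF Z"
  have "G (G e e \<odot> Y) Z p = G e e p * G Y Z p" using Z by (simp add: G_simps)
  then show "G (G e e \<odot> Y) Z p
      = G (G Y e \<odot> e + G Y (J e) \<odot> J e + (\<lambda>p. G e e p * G Y \<xi> p) \<odot> \<xi>) Z p"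
    unfolding adapted_expansion[OF e Y Z] using Z by (simp add: G_simps)
qed (use horizontalD(1)[OF e] Y in simp_all)

text \<open>This is where the contact condition enters. In dimension 3 each summand has a single
  factor d \<eta>, so d \<eta> is nonzero on some pair at \<open>p\<close>; it sees only horizontal
  parts, so one of these does not vanish at \<open>p\<close>.\<close>

lemma ex_unit_horizontal: obtains e where "horizontal e" "G e e p = 1"
proof -
  have "contact_at A \<eta> p" using contact unfolding contact_metric_def by blast
  then obtain X where X: "\<And>i. i < DIM(real^3) \<Longrightarrow> VF (X i)"
    and "(\<Sum>\<pi> | \<pi> permutes {..<DIM(real^3)}. real_of_int (sign \<pi>) * form_app \<eta> (X (\<pi> 0)) p *
        (\<Prod>i<(DIM(real^3) - 1) div 2. ext_deriv \<eta> (X (\<pi> (2*i+1))) (X (\<pi> (2*i+2))) p)) \<noteq> 0"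
    unfolding contact_at_def by blast
  then obtain \<pi> where \<pi>: "\<pi> permutes {..<DIM(real^3)}"
    and "(\<Prod>i<(DIM(real^3) - 1) div 2. ext_deriv \<eta> (X (\<pi> (2*i+1))) (X (\<pi> (2*i+2))) p) \<noteq> 0"
    by (metis (no_types, lifting) mem_Collect_eq mult_zero_right sum.neutral)
  then have "ext_deriv \<eta> (X (\<pi> 1)) (X (\<pi> 2)) p \<noteq> 0" by (simp add: numeral_2_eq_2)
  moreover have V: "VF (X (\<pi> 1))" "VF (X (\<pi> 2))"
    using X permutes_in_image[OF \<pi>, of 1] permutes_in_image[OF \<pi>, of 2] by simp_all
  ultimately have nz: "G (X (\<pi> 1)) (J (X (\<pi> 2))) p \<noteq> 0" by (simp add: ext_deriv_eq)
  define e where "e = X (\<pi> 2) - G (X (\<pi> 2)) \<xi> \<odot> \<xi>"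
  have e: "horizontal e" unfolding e_def by (rule horizontal_part[OF V(2)])
  note [simp] = horizontalD(1)[OF e]
  have "G (X (\<pi> 1)) (J (X (\<pi> 2))) p = G (X (\<pi> 1)) (J e) p"
    using V by (simp add: e_def J_diff J_scale J_xi G_simps)
  also have "\<dots> = - G (J (X (\<pi> 1))) e p" using V by (simp add: G_J_skew)
  finally have "e p \<noteq> 0" using nz G_zero_right[OF VF_J[OF V(1)], of p] by (auto simp: bilin_app_def)
  then have pos: "G e e p > 0" using G_eq_0_iff[of e p] G_nonneg[of e p] by simp
  let ?c = "\<lambda>_::'a. 1 / sqrt (G e e p)"
  have "G (?c \<odot> e) (?c \<odot> e) p = 1" using pos by (simp add: G_simps field_simps)
  then show ?thesis using that[of "?c \<odot> e"] e by (simp add: horizontal_scale)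
qed

text \<open>The choice in \<open>frame_at\<close> is meaningful because an adapted basis exists at
  every point.\<close>

lemma frame_orthonormal: "orthonormal_at A g p (frame_at A g p)"
proof -
  obtain e where "horizontal e" "G e e p = 1" by (rule ex_unit_horizontal)
  from someI[of "orthonormal_at A g p", OF orthonormal_adapted[OF this]]
  show ?thesis unfolding frame_at_def .
qed

lemma frame_VF [simp]: "VF (frame_at A g p 0)" "VF (frame_at A g p 1)" "VF (frame_at A g p (Suc 0))" "VF (frame_at A g p 2)"
  using orthonormal_VF[OF frame_orthonormal] by simp_all

section \<open>The Ricci tensor in adapted bases\<close>

text \<open>Independence of the trace from the chosen frame. Each frame vector is expanded in
  \<open>e\<close>, \<open>J e\<close> and \<xi> in the first curvature slot; Parseval's identity
  for the frame then resums the coefficients.\<close>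

lemma ricci_adapted:
  assumes e: "horizontal e" and X: "VF X" "VF Y"
  shows "G e e p * Ric X Y p =
    G (R e X Y) e p + G (R (J e) X Y) (J e) p + G e e p * G (R \<xi> X Y) \<xi> p"
proof -
  note [simp] = horizontalD(1)[OF e] X
  let ?E = "frame_at A g p"
  have exp: "G e e p * G (R V X Y) V p = G V e p * G (R e X Y) V p
      + G V (J e) p * G (R (J e) X Y) V p + G e e p * G V \<xi> p * G (R \<xi> X Y) V p" if V: "VF V" for V
  proof -
    have "G e e p * G (R V X Y) V p = G (R (G e e \<odot> V) X Y) V p"
      using V by (simp add: R_scale_left G_simps)
    also have "\<dots> = G V e p * G (R e X Y) V p
      + G V (J e) p * G (R (J e) X Y) V p + G e e p * G V \<xi> p * G (R \<xi> X Y) V p"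
      unfolding adapted_expansion_field[OF e V] using V by (simp add: R_add_left R_scale_left G_simps)
    finally show ?thesis .
  qed
  have par: "G W Z p = G W (?E 0) p * G (?E 0) Z p + G W (?E 1) p * G (?E 1) Z p + G W (?E 2) p * G (?E 2) Z p"
    if "VF W" "VF Z" for W Z
    using orthonormal_parseval[OF frame_orthonormal that] unfolding sum_less_3 .
  have "G e e p * Ric X Y p = G e e p * G (R (?E 0) X Y) (?E 0) p + G e e p * G (R (?E 1) X Y) (?E 1) p
      + G e e p * G (R (?E 2) X Y) (?E 2) p"
    unfolding ricci_def sum_less_3 by (simp only: distrib_left)
  also have "\<dots> = G (R e X Y) e p + G (R (J e) X Y) (J e) p + G e e p * G (R \<xi> X Y) \<xi> p"
    unfolding exp[OF frame_VF(1)] exp[OF frame_VF(2)] exp[OF frame_VF(4)]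
    using par[of "R e X Y" e] par[of "R (J e) X Y" "J e"] par[of "R \<xi> X Y" \<xi>]
    by (simp add: algebra_simps)
  finally show ?thesis .
qed

lemma ricci_add_right: "VF X \<Longrightarrow> VF Y \<Longrightarrow> VF Z \<Longrightarrow> Ric X (Y + Z) p = Ric X Y p + Ric X Z p"
  unfolding ricci_def sum_less_3 by (simp add: R_add_right G_simps)

lemma ricci_scale_right: "VF X \<Longrightarrow> VF Y \<Longrightarrow> SM f \<Longrightarrow> Ric X (f \<odot> Y) p = f p * Ric X Y p"
  unfolding ricci_def sum_less_3 by (simp add: R_scale_right G_simps algebra_simps)

text \<open>The definite description in \<open>ricci_operator\<close> has to be shown to denote:
  existence comes from expanding the second argument of \<open>Ric\<close> in an adapted basis,
  uniqueness from orthonormal expansion.\<close>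

lemma ricci_operator_eigenfield:
  assumes X: "VF X" and Q: "ricci_operator A g D X = \<sigma> \<odot> X" and Y: "VF Y"
  shows "Ric X Y p = \<sigma> p * G X Y p"
proof -
  let ?P = "\<lambda>v. v \<in> tangent_space A p \<and> (\<forall>Y. VF Y \<longrightarrow> Ric X Y p = g p v (Y p))"
  obtain e where e: "horizontal e" "G e e p = 1" by (rule ex_unit_horizontal)
  note [simp] = horizontalD(1)[OF e(1)] X
  \<comment> \<open>The metric dual of \<open>Ric X\<close> at \<open>p\<close>, with coefficients
    constant so that it is a field.\<close>
  define V where "V = (\<lambda>_. Ric X e p) \<odot> e + (\<lambda>_. Ric X (J e) p) \<odot> J e + (\<lambda>_. Ric X \<xi> p) \<odot> \<xi>"
  have V: "VF V" by (simp add: V_def)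
  have "Ric X Y p = G V Y p" if Y: "VF Y" for Y
  proof -
    have "Ric X Y p = Ric X (G e e \<odot> Y) p" using Y e(2) by (simp add: ricci_scale_right)
    also have "\<dots> = G V Y p"
      unfolding adapted_expansion_field[OF e(1) Y] V_def using Y e(2)
      by (simp add: ricci_add_right ricci_scale_right G_simps G_sym[OF Y])
    finally show ?thesis .
  qed
  then have PV: "?P (V p)" using vector_field_tangent[OF V] by (simp add: bilin_app_def)
  have uniq: "v = w" if v: "?P v" and w: "?P w" for v w
  proof -
    have T: "v \<in> tangent_space A p" "w \<in> tangent_space A p" using v w by auto
    have vw: "v - w \<in> tangent_space A p"
      using subspace_diff[OF subspace_tangent_space] T by metis
    have "g p (v - w) (Y p) = 0" if Y: "VF Y" for Y
    proof -
      note Yp = vector_field_tangent[OF Y, of p]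
      have "g p v (Y p) = g p w (Y p)" using v w Y by metis
      moreover have "g p (Y p) ((v - w) + w) = g p (Y p) (v - w) + g p (Y p) w"
        by (rule g_linear(1)[OF Yp vw T(2)])
      ultimately show ?thesis
        using g_linear(3)[OF Yp vw Yp] g_linear(3)[OF Yp T(1) Yp] g_linear(3)[OF Yp T(2) Yp]
        by (simp only: diff_add_cancel)
    qed
    then have "v - w = 0"
      using orthonormal_tangent_expansion[OF atlas metric frame_orthonormal vw] unfolding sum_less_3
      by simp
    then show ?thesis by simp
  qed
  have "?P (THE v. ?P v)" by (rule theI[where P = ?P, OF PV uniq[OF _ PV]])
  moreover have "(THE v. ?P v) = (\<sigma> \<odot> X) p"
    using fun_cong[OF Q, of p] unfolding ricci_operator_def .
  ultimately have "?P ((\<sigma> \<odot> X) p)" by simp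
  then have "Ric X Y p = G (\<sigma> \<odot> X) Y p" using Y by (simp add: bilin_app_def)
  then show ?thesis using Y by (simp add: G_simps)
qed

lemma R_diag:
  assumes "VF X" "VF Y" "VF Z" shows "G (R X X Y) Z p = 0"
proof -
  have "G (R X X Y) Z p = G (- R X X Y) Z p"
    using R_skew[OF assms(1,1,2)] by (rule arg_cong)
  then show ?thesis using assms by (simp add: G_uminus_left)
qed

lemma R_diag': "VF X \<Longrightarrow> VF Y \<Longrightarrow> VF Z \<Longrightarrow> G (R X Y Z) Z p = 0"
  using R_skew_G[of X Y Z Z p] by simp

lemma R_swap: "VF X \<Longrightarrow> VF Y \<Longrightarrow> VF Z \<Longrightarrow> VF W \<Longrightarrow> G (R X Y Z) W p = G (R Y X W) Z p"
  using R_skew[of X Y Z] R_skew_G[of Y X Z W p] by (simp add: G_uminus_left)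

text \<open>\<open>N\<close> and \<open>S\<close> both anticommute with \<open>J\<close>, so the
  contributions of \<open>e\<close> and \<open>J e\<close> cancel in the term linear in
  \<open>N\<close> and add up in the term quadratic in \<open>S\<close>. The identity holds for
  horizontal \<open>e\<close> of any length and can therefore be differentiated.\<close>

lemma ricci_xi_xi:
  assumes e: "horizontal e"
  shows "G e e p * Ric \<xi> \<xi> p = 2 * G e e p - 2 * G (S e) (S e) p"
proof -
  note [simp] = horizontalD(1)[OF e]
  show ?thesis
    unfolding ricci_adapted[OF e VF_xi VF_xi]
    using e G_J_horizontal[OF e, of "N e" p] G_J_J[of "S e" "S e" p] G_J_skew[of "N e" "J e" p]
      G_J_J[of "N e" e p] G_J_horizontal[OF e, of e p] G_J_skew[of "J e" e p]
      G_J_skew[of "J (J e)" "J e" p] G_J_horizontal[OF horizontal_J[OF e], of "J e" p]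
    by (simp add: G_R_xi_xi R_diag N_J S_J G_simps G_S_xi horizontalD)
qed

text \<open>The curvature of the plane of \<open>e\<close> and \<open>J e\<close> enters both
  diagonal values equally and cancels in the difference. What remains comes from
  \<open>G_R_xi_xi\<close>, whose part anticommuting with \<open>J\<close> is
  \<open>N\<close>.\<close>

lemma ricci_horizontal:
  assumes e: "horizontal e" "G e e p = 1"
  shows "Ric e e p - Ric (J e) (J e) p = - 2 * G (N e) e p"
    and "Ric e (J e) p = - G (N e) (J e) p"
proof -
  note [simp] = horizontalD(1)[OF e(1)]
  have JJe: "G (J (J e)) Z p = - G e Z p" if "VF Z" for Z
    using that e by (simp add: J_J G_simps horizontalD)
  have "Ric e e p = G (R e (J e) (J e)) e p + G (R e \<xi> \<xi>) e p"
    using ricci_adapted[OF e(1), of e e p] e(2) R_swap[of "J e" e e "J e" p] R_swap[of \<xi> e e \<xi> p]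
    by (simp add: R_diag)
  moreover have "Ric (J e) (J e) p = G (R e (J e) (J e)) e p + G (R (J e) \<xi> \<xi>) (J e) p"
    using ricci_adapted[OF e(1), of "J e" "J e" p] e(2) R_swap[of \<xi> "J e" "J e" \<xi> p]
    by (simp add: R_diag)
  moreover have "G (R e \<xi> \<xi>) e p = - G (N e) e p - G (S e) (S e) p + 1"
    using JJe[of e] e(2) by (simp add: G_R_xi_xi)
  moreover have "G (R (J e) \<xi> \<xi>) (J e) p = G (N e) e p - G (S e) (S e) p + 1"
  proof -
    have "G (J (J (J e))) (J e) p = - 1"
      using JJe[of e] e G_J_J[of "J (J e)" e p] by (simp add: horizontalD)
    then show ?thesis
      using e G_J_J[of "S e" "S e" p] G_J_J[of "N e" e p]
      by (simp add: G_R_xi_xi N_J S_J G_simps G_S_xi horizontalD)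
  qed
  ultimately show "Ric e e p - Ric (J e) (J e) p = - 2 * G (N e) e p" by simp
  have "Ric e (J e) p = G (R e \<xi> \<xi>) (J e) p"
    using ricci_adapted[OF e(1), of e "J e" p] e(2) R_swap[of \<xi> e "J e" \<xi> p]
    by (simp add: R_diag R_diag')
  also have "\<dots> = - G (N e) (J e) p"
    using JJe[of "J e"] G_e_J_e[of e p] G_e_J_e[of "S e" p] by (simp add: G_R_xi_xi S_J G_simps)
  finally show "Ric e (J e) p = - G (N e) (J e) p" .
qed

section \<open>Consequences of the eigenvalue condition and the soliton equation\<close>

context
  fixes \<sigma> :: "'a \<Rightarrow> real"
  assumes sigma: "SM \<sigma>" "ricci_operator A g D \<xi> = \<sigma> \<odot> \<xi>"
begin

lemma G_S_S_diag: "horizontal e \<Longrightarrow> G (S e) (S e) p = G e e p * (1 - \<sigma> p / 2)"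
  using ricci_xi_xi[of e p] ricci_operator_eigenfield[OF VF_xi sigma(2) VF_xi, of p]
  by (simp add: G_xi_xi algebra_simps)

text \<open>Polarisation of \<open>G_S_S_diag\<close>; it is applied with \<open>D \<xi> e\<close>
  as one argument.\<close>

lemma G_S_S:
  assumes "horizontal e" "horizontal e'"
  shows "G (S e) (S e') p = G e e' p * (1 - \<sigma> p / 2)"
  using G_S_S_diag[OF assms(1), of p] G_S_S_diag[OF assms(2), of p] G_S_S_diag[OF horizontal_add[OF assms], of p]
    horizontalD(1)[OF assms(1)] horizontalD(1)[OF assms(2)] G_sym[of e e' p] G_sym[of "S e" "S e'" p]
  by (simp add: S_add G_simps algebra_simps)

text \<open>Differentiate \<open>G_S_S_diag\<close> along \<xi>. The terms containing
  \<open>D \<xi> e\<close> agree on both sides by \<open>G_S_S\<close>, and the derivative of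
  \<sigma> vanishes at \<open>p\<close>.\<close>

lemma G_N_S:
  assumes e: "horizontal e" and xi_sigma: "deriv_along \<xi> \<sigma> p = 0"
  shows "G (N e) (S e) p = 0"
proof -
  note [simp] = horizontalD(1)[OF e]
  \<comment> \<open>Division by 2 is hidden in a constant so that \<open>deriv_mult\<close>
    matches.\<close>
  define c :: real where "c = 1 / 2"
  have "G (S e) (S e) = (\<lambda>q. G e e q * (1 - \<sigma> q * c))"
    using G_S_S_diag[OF e] by (simp add: fun_eq_iff c_def)
  then have "deriv_along \<xi> (G (S e) (S e)) p = deriv_along \<xi> (\<lambda>q. G e e q * (1 - \<sigma> q * c)) p"
    by simp
  also have "\<dots> = (1 - \<sigma> p * c) * (2 * G (D \<xi> e) e p)"
    using sigma(1) xi_sigma G_sym[of e "D \<xi> e" p] by (simp add: deriv_mult deriv_diff deriv_const deriv_G)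
  finally have "deriv_along \<xi> (G (S e) (S e)) p = (1 - \<sigma> p / 2) * (2 * G (D \<xi> e) e p)"
    by (simp add: c_def)
  moreover have "deriv_along \<xi> (G (S e) (S e)) p = 2 * G (N e) (S e) p + 2 * G (S (D \<xi> e)) (S e) p"
    using G_sym[of "S e" "D \<xi> (S e)" p] by (simp add: deriv_G N_def G_simps)
  ultimately show ?thesis
    using G_S_S[OF horizontal_D_xi[OF e] e, of p] by (simp add: algebra_simps)
qed

lemma soliton_function_vanishes:
  assumes xi_sigma: "deriv_along \<xi> \<sigma> p = 0" and f: "SM f"
    and soliton: "almost_RB_soliton A g D (f \<odot> \<xi>) \<Lambda> \<rho>"
    and p: "p \<in> h_nonzero_set A \<phi> \<xi>"
  shows "f p = 0"
proof -
  obtain e where e: "horizontal e" "G e e p = 1" by (rule ex_unit_horizontal)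
  note [simp] = horizontalD(1)[OF e(1)]
  \<comment> \<open>On horizontal fields the derivatives of \<open>f\<close> in the Lie derivative
    are multiplied by inner products with \<xi>, which are zero.\<close>
  have sol: "Ric X Y p = (\<Lambda> p + \<rho> * scalar_curvature A g D p) * G X Y p - f p * G (S X) Y p"
    if "horizontal X" "horizontal Y" for X Y
  proof -
    note hor = horizontalD[OF that(1)] horizontalD[OF that(2)]
    have "Ric X Y p + (1/2) * lie_deriv_bilin (f \<odot> \<xi>) g X Y p
        = (\<Lambda> p + \<rho> * scalar_curvature A g D p) * G X Y p"
      using soliton hor unfolding almost_RB_soliton_def by blast
    moreover have "lie_deriv_bilin (f \<odot> \<xi>) g X Y p = 2 * f p * G (S X) Y p"
      using hor by (simp add: lie_deriv_G_collinear[OF f])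
    ultimately show ?thesis by simp
  qed
  \<comment> \<open>In the difference of the soliton equations for \<open>e\<close> and
    \<open>J e\<close> the common multiple of the metric cancels, including the scalar curvature
    term.\<close>
  have "- 2 * G (N e) e p = - 2 * f p * G (S e) e p"
    using ricci_horizontal(1)[OF e] sol[OF e(1) e(1)] sol[OF horizontal_J[OF e(1)] horizontal_J[OF e(1)]]
      G_J_horizontal[OF e(1), of e p] G_J_J[of "S e" e p] e(1)
    by (simp add: S_J G_simps G_S_xi horizontalD algebra_simps)
  then have Ne: "G (N e) e p = f p * G (S e) e p" by simp
  have NJe: "G (N e) (J e) p = f p * G (S e) (J e) p"
    using ricci_horizontal(2)[OF e] sol[OF e(1) horizontal_J[OF e(1)]] G_e_J_e[of e p] by simp
  \<comment> \<open>\<open>N e\<close> and \<open>f \<odot> S e\<close> have the same inner products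
    with \<open>e\<close> and \<open>J e\<close> at \<open>p\<close>, and \<open>S e\<close> is
    horizontal, so pairing with \<open>S e\<close> cannot tell them apart.\<close>
  have "G (N e) (S e) p = f p * (G (S e) e p * G e (S e) p + G (S e) (J e) p * G (J e) (S e) p)"
    using adapted_expansion[OF e(1), of "N e" "S e" p] e(2) Ne NJe by (simp add: G_S_xi algebra_simps)
  also have "\<dots> = f p * G (S e) (S e) p"
    using adapted_expansion[OF e(1), of "S e" "S e" p] e(2) by (simp add: G_S_xi)
  finally have "f p * (1 - \<sigma> p / 2) = 0"
    using G_N_S[OF e(1) xi_sigma] G_S_S_diag[OF e(1), of p] e(2) by simp
  \<comment> \<open>If this factor vanished, \<open>S\<close> would be zero at \<open>p\<close> on
    horizontal fields, and on all fields since \<open>S \<xi> = 0\<close>; that contradicts the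
    choice of \<open>p\<close>.\<close>
  moreover have "1 - \<sigma> p / 2 \<noteq> 0"
  proof
    assume s0: "1 - \<sigma> p / 2 = 0"
    obtain X where X: "VF X" "S X p \<noteq> 0" using p unfolding h_nonzero_set_eq by blast
    have "S (X - G X \<xi> \<odot> \<xi>) = S X"
      by (rule field_eqI) (use X(1) in \<open>simp_all add: S_diff S_scale S_xi G_simps\<close>)
    then have "G (S X) (S X) p = 0"
      using G_S_S_diag[OF horizontal_part[OF X(1)], of p] s0 by simp
    then show False using G_eq_0_iff[OF VF_S[OF X(1)], of p] X(2) by simp
  qed
  ultimately show ?thesis by simp
qed

end

section \<open>From vanishing \<open>h\<close> to K-contact and Sasakian structures\<close>

text \<open>The defect \<open>B\<close> of the Sasakian identity is linear in \<open>Y\<close> over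
  smooth functions, so it suffices to test it on \<xi>, \<open>e\<close> and
  \<open>J e\<close>.\<close>

lemma D_J_sasakian:
  assumes S0: "\<And>X. VF X \<Longrightarrow> S X = 0" and X: "VF X" and Y: "VF Y"
  shows "D X (J Y) - J (D X Y) = G X Y \<odot> \<xi> - G Y \<xi> \<odot> X"
proof -
  define B where "B Y = D X (J Y) - J (D X Y) - (G X Y \<odot> \<xi> - G Y \<xi> \<odot> X)" for Y
  note [simp] = X
  have VB [simp]: "VF (B Y)" if "VF Y" for Y using that by (simp add: B_def)
  have DX: "D X \<xi> = - J X" using S0[OF X] by (simp add: D_xi_eq)
  have G_B: "G (B Y) Z p = G (D X (J Y)) Z p - G (J (D X Y)) Z p - G X Y p * G \<xi> Z p + G Y \<xi> p * G X Z p"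
    if "VF Y" "VF Z" for Y Z p
    using that by (simp add: B_def G_simps)
  have B_scale: "G (B (f \<odot> Y)) Z p = f p * G (B Y) Z p" if "VF Y" "VF Z" "SM f" for f Y Z p
    using that by (simp add: G_B J_scale D_scale_right J_add G_simps algebra_simps)
  have B_add: "G (B (Y + Y')) Z p = G (B Y) Z p + G (B Y') Z p" if "VF Y" "VF Y'" "VF Z" for Y Y' Z p
    using that by (simp add: G_B J_add D_add_right G_simps algebra_simps)
  have B_xi: "G (B \<xi>) Z p = 0" if "VF Z" for Z p
    using that by (simp add: G_B J_xi D_zero_right DX J_uminus J_J G_xi_xi G_simps)
  have B_horizontal: "G (B e) Z p = 0" if e: "horizontal e" "G e e p = 1" and Z: "VF Z" for e Z p
  proof -
    note [simp] = horizontalD(1)[OF e(1)] Z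
    \<comment> \<open>Differentiating these three relations along \<open>X\<close> gives the
      components of \<open>B e\<close> along \<xi>, \<open>e\<close> and \<open>J e\<close>.\<close>
    have const: "G (J e) \<xi> = (\<lambda>_. 0)" "G (J e) e = (\<lambda>_. 0)" "G (J e) (J e) = G e e"
      using horizontal_J[OF e(1)] e(1)
      by (auto simp: horizontal_def G_e_J_e G_J_horizontal intro!: ext)
    have "G (B e) \<xi> p = 0"
      using deriv_G[of "J e" \<xi> X p] G_J_horizontal[OF e(1) X, of p] G_sym[of X e p] e(1)
      by (simp add: const G_B DX G_J_xi G_xi_xi G_simps horizontalD deriv_const)
    moreover have "G (B e) e p = 0"
      using deriv_G[of "J e" e X p] e(1) G_J_skew[of "D X e" e p] G_sym[of "J e" "D X e" p]
      by (simp add: const G_B horizontalD deriv_const)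
    moreover have "G (B e) (J e) p = 0"
      using deriv_G[of "J e" "J e" X p] deriv_G[of e e X p] e(1) G_J_J[of "D X e" e p]
        G_sym[of "J e" "D X (J e)" p] G_sym[of e "D X e" p] horizontalD(2,3)[OF horizontal_J[OF e(1)], of p]
      by (simp add: const G_B horizontalD)
    ultimately show ?thesis
      using adapted_expansion[OF e(1), of "B e" Z p] e(2) by simp
  qed
  have "B Y = 0"
  proof (rule field_eqI)
    fix Z p assume Z: "VF Z"
    obtain e where e: "horizontal e" "G e e p = 1" by (rule ex_unit_horizontal)
    note [simp] = horizontalD(1)[OF e(1)] Z Y
    have "G (B Y) Z p = G (B (G e e \<odot> Y)) Z p" using e(2) by (simp add: B_scale)
    also have "\<dots> = 0"
      unfolding adapted_expansion_field[OF e(1) Y]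
      using B_horizontal[OF e Z] B_horizontal[OF horizontal_J[OF e(1)] _ Z, of p]
        G_J_horizontal[OF e(1), of e p] e(2)
      by (simp add: B_add B_scale B_xi)
    finally show "G (B Y) Z p = G 0 Z p" by (simp add: G_zero_left)
  qed (use Y in simp_all)
  then show ?thesis by (simp add: B_def)
qed

text \<open>With \<open>S = 0\<close> the covariant derivative of \<xi> is the skew operator
  \<open>- J\<close>, which makes \<xi> Killing; \<open>D_J_sasakian\<close> applies to the same
  situation.\<close>

lemma K_contact_sasakian:
  assumes "h_nonzero_set A \<phi> \<xi> = {}"
  shows "K_contact A \<phi> \<xi> \<eta> g" and "sasakian A \<phi> \<xi> \<eta> g D"
proof -
  have S0: "S X = 0" if "VF X" for X
    using assms that unfolding h_nonzero_set_eq by (auto intro!: ext)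
  have "lie_deriv_bilin \<xi> g X Y = 0" if X: "VF X" and Y: "VF Y" for X Y
  proof
    fix p
    show "lie_deriv_bilin \<xi> g X Y p = 0 p"
      using X Y S0 G_J_skew[OF X Y, of p] by (simp add: lie_deriv_G D_xi_eq G_simps)
  qed
  then show "K_contact A \<phi> \<xi> \<eta> g" using contact by (simp add: K_contact_def killing_def)
  show "sasakian A \<phi> \<xi> \<eta> g D"
    using contact D_J_sasakian[OF S0] eta_eq unfolding sasakian_def by simp
qed

end

section \<open>Vanishing of the potential function where \<open>h\<close> is nonzero, and the
  Sasakian conclusion\<close>

theorem theorem3p6:
  fixes A :: "('a::{t2_space,second_countable_topology}, real^3) atlas"
    and \<phi> :: "'a endo_field" and \<xi> :: "'a vfield" and \<eta> :: "'a one_form" and g :: "'a bilin_field"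
    and D :: "'a vfield \<Rightarrow> 'a vfield \<Rightarrow> 'a vfield"
    and \<sigma> :: "'a \<Rightarrow> real"
  assumes contact: "contact_metric A \<phi> \<xi> \<eta> g"
    and connection: "levi_civita A g D"
    and sigma_smooth: "smooth_fun A \<sigma>"
    and Q_xi: "ricci_operator A g D \<xi> = \<sigma> \<odot> \<xi>"
    and xi_sigma: "deriv_along \<xi> \<sigma> = 0"
  shows "open (h_nonzero_set A \<phi> \<xi>) \<and>
    (\<forall>V f \<Lambda> \<rho>. smooth_fun A f \<longrightarrow> V = f \<odot> \<xi> \<longrightarrow> almost_RB_soliton A g D V \<Lambda> \<rho> \<longrightarrow>
       (\<forall>p\<in>h_nonzero_set A \<phi> \<xi>. f p = 0) \<and>
       (nowhere_vanishing V \<longrightarrow>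
          h_nonzero_set A \<phi> \<xi> = {} \<and> K_contact A \<phi> \<xi> \<eta> g \<and> sasakian A \<phi> \<xi> \<eta> g D)) \<and>
    (\<not> sasakian A \<phi> \<xi> \<eta> g D \<longrightarrow>
       \<not> (\<exists>V \<Lambda> \<rho>. almost_RB_soliton A g D V \<Lambda> \<rho> \<and> nowhere_vanishing V \<and>
            pointwise_collinear A V \<xi>))"
proof -
  interpret contact_metric_3_manifold A g D \<phi> \<xi> \<eta>
    using contact connection by unfold_locales (auto simp: contact_metric_def)
  have f0: "f p = 0"
    if "smooth_fun A f" "almost_RB_soliton A g D (f \<odot> \<xi>) \<Lambda> \<rho>" "p \<in> h_nonzero_set A \<phi> \<xi>" for f \<Lambda> \<rho> p
    using soliton_function_vanishes[OF sigma_smooth Q_xi _ that] xi_sigma by simp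
  have nowhere: "h_nonzero_set A \<phi> \<xi> = {}"
    if f: "smooth_fun A f" and sol: "almost_RB_soliton A g D (f \<odot> \<xi>) \<Lambda> \<rho>"
      and nz: "nowhere_vanishing (f \<odot> \<xi>)" for f \<Lambda> \<rho>
  proof (rule equals0I)
    fix p assume "p \<in> h_nonzero_set A \<phi> \<xi>"
    then have "f p = 0" by (rule f0[OF f sol])
    then have "(f \<odot> \<xi>) p = 0" unfolding scale_field_apply by (simp only: scale_zero_left)
    then show False using nz unfolding nowhere_vanishing_def by blast
  qed
  have "sasakian A \<phi> \<xi> \<eta> g D"
    if "almost_RB_soliton A g D V \<Lambda> \<rho>" "nowhere_vanishing V" "pointwise_collinear A V \<xi>" for V \<Lambda> \<rho>
    using that K_contact_sasakian(2)[OF nowhere] unfolding pointwise_collinear_def by blast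
  then show ?thesis
    using open_h_nonzero_set f0 nowhere K_contact_sasakian by blast
qed

end
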